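(* Let $0\le\lambda<\infty$, $0<p<\infty$, $\vec q=(q_1,\dots,q_n)$ with $1<q_i<\infty$ for all $i$, and $$-\sum_{i=1}^n\frac1{q_i}+\lambda<\alpha<n\Big(1-\frac1n\sum_{i=1}^n\frac1{q_i}\Big).$$ Let $b\in BMO(\mathbb R^n)$ and suppose that the Hardy-Littlewood maximal commutator $M_b$ is bounded on $L^{\vec q}(\mathbb R^n)$. Then $M_b$ is bounded on $M\dot K^{\alpha,\lambda}_{p,\vec q}(\mathbb R^n)$, i.e. there is a constant $C$ with $\|M_bf\|_{M\dot K^{\alpha,\lambda}_{p,\vec q}}\le C\|f\|_{M\dot K^{\alpha,\lambda}_{p,\vec q}}$ for all $f\in M\dot K^{\alpha,\lambda}_{p,\vec q}(\mathbb R^n)$.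
   Context: The Hardy-Littlewood maximal commutator of $b\in BMO(\mathbb R^n)$ is $$M_bf(x)=\sup_{r>0}\frac1{|B(x,r)|}\int_{B(x,r)}|b(x)-b(y)||f(y)|\,dy,\qquad B(x,r)=\{y\in\mathbb R^n:|x-y|\le r\}.$$ For $k\in\mathbb Z$: $B_k=\{x\in\mathbb R^n:|x|\le 2^k\}$, $A_k=B_k\setminus B_{k-1}$, $\chi_k=\chi_{A_k}$ (characteristic function). Mixed Lebesgue space: for $\vec q=(q_1,\dots,q_n)\in(0,\infty)^n$, $L^{\vec q}(\mathbb R^n)$ is the set of measurable $f$ with $$\|f\|_{L^{\vec q}}=\Big(\int_{\mathbb R}\cdots\Big(\int_{\mathbb R}\Big(\int_{\mathbb R}|f(x_1,\dots,x_n)|^{q_1}dx_1\Big)^{q_2/q_1}dx_2\Big)^{q_3/q_2}\cdots dx_n\Big)^{1/q_n}<\infty.$$ Homogeneous mixed Herz-Morrey space: for $\alpha\in\mathbb R$, $0<p<\infty$, $0\le\lambda<\infty$, $\vec q\in[1,\infty)^n$, $M\dot K^{\alpha,\lambda}_{p,\vec q}(\mathbb R^n)$ is the set of $f\in L^{\vec q}_{loc}(\mathbb R^n\setminus\{0\})$ with $$\|f\|_{M\dot K^{\alpha,\lambda}_{p,\vec q}}=\sup_{k_0\in\mathbb Z}2^{-k_0\lambda}\Big\{\sum_{k=-\infty}^{k_0}2^{k\alpha p}\|f\chi_k\|_{L^{\vec q}}^p\Big\}^{1/p}<\infty.$$ *)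

theory Defs
  imports "HOL-Analysis.Analysis"
begin

text \<open>
  Functions on \<open>\<real>\<^sup>n\<close> are Lebesgue measurable and extended real valued, so that the maximal
  commutator, which may be infinite at some points, maps functions to functions of the same kind.
  The index type \<open>'n\<close> of \<open>real ^ 'n\<close> is linearly ordered because the mixed norm depends on the
  order in which the coordinates are integrated.
\<close>

text \<open>Powers with a positive exponent on \<open>[0, \<infinity>]\<close>.\<close>

definition ennpow :: "ennreal \<Rightarrow> real \<Rightarrow> ennreal" where
  "ennpow a p = (if a = \<infinity> then \<infinity> else ennreal (enn2real a powr p))"

definition vec_upd :: "real ^ 'n \<Rightarrow> 'n \<Rightarrow> real \<Rightarrow> real ^ 'n" where
  "vec_upd x i t = (\<chi> j. if j = i then t else x $ j)"

text \<open>
  \<open>mixed_iter q s [i, j, \<dots>] g\<close> integrates out coordinate \<open>i\<close> of \<open>g\<close> raised to the power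
  \<open>q\<^sub>i / s\<close>, then coordinate \<open>j\<close> of the result raised to the power \<open>q\<^sub>j / q\<^sub>i\<close>, and so on; the
  final result is raised to the power \<open>1 / q\<^sub>l\<close>, where \<open>l\<close> is the last coordinate.  So \<open>s\<close> is the
  exponent belonging to the previously integrated coordinate.  For a Lebesgue measurable function,
  the integrals are of measurable functions for almost all values of the remaining coordinates.
\<close>

fun mixed_iter ::
    "real ^ 'n \<Rightarrow> real \<Rightarrow> 'n list \<Rightarrow> (real ^ 'n \<Rightarrow> ennreal) \<Rightarrow> real ^ 'n \<Rightarrow> ennreal" where
  "mixed_iter q s [] g = (\<lambda>x. ennpow (g x) (1 / s))"
| "mixed_iter q s (i # is) g =
     mixed_iter q (q $ i) is (\<lambda>x. \<integral>\<^sup>+ t. ennpow (g (vec_upd x i t)) (q $ i / s) \<partial>lebesgue)"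

text \<open>
  Once all coordinates are integrated out the result is a constant function, so the point \<open>0\<close> at
  which it is evaluated is irrelevant.
\<close>

definition mixed_norm ::
    "real ^ 'n::{finite,linorder} \<Rightarrow> (real ^ 'n::{finite,linorder} \<Rightarrow> ereal) \<Rightarrow> ennreal" where
  "mixed_norm q f =
     mixed_iter q 1 (sorted_list_of_set UNIV) (\<lambda>x. e2ennreal \<bar>f x\<bar>) 0"

definition mixed_Lebesgue ::
    "real ^ 'n::{finite,linorder} \<Rightarrow> (real ^ 'n::{finite,linorder} \<Rightarrow> ereal) set" where
  "mixed_Lebesgue q = {f \<in> borel_measurable lebesgue. mixed_norm q f < \<infinity>}"

definition mixed_Lebesgue_loc ::
    "(real ^ 'n::{finite,linorder}) set \<Rightarrow> real ^ 'n::{finite,linorder} \<Rightarrow>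
       (real ^ 'n::{finite,linorder} \<Rightarrow> ereal) set" where
  "mixed_Lebesgue_loc U q =
     {f. \<forall>K. compact K \<and> K \<subseteq> U \<longrightarrow> (\<lambda>x. f x * indicator K x) \<in> mixed_Lebesgue q}"

definition dyadic_annulus :: "int \<Rightarrow> (real ^ 'n) set" where
  "dyadic_annulus k = cball 0 (2 powr real_of_int k) - cball 0 (2 powr real_of_int (k - 1))"

definition herz_morrey_norm ::
    "real \<Rightarrow> real \<Rightarrow> real \<Rightarrow> real ^ 'n::{finite,linorder} \<Rightarrow>
       (real ^ 'n::{finite,linorder} \<Rightarrow> ereal) \<Rightarrow> ennreal" where
  "herz_morrey_norm \<alpha> lam p q f =
     (SUP k0::int. ennreal (2 powr (- real_of_int k0 * lam)) *
        ennpow (\<Sum>\<^sub>\<infinity>k\<in>{..k0}. ennreal (2 powr (real_of_int k * \<alpha> * p)) *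
                  ennpow (mixed_norm q (\<lambda>x. f x * indicator (dyadic_annulus k) x)) p)
               (1 / p))"

definition herz_morrey ::
    "real \<Rightarrow> real \<Rightarrow> real \<Rightarrow> real ^ 'n::{finite,linorder} \<Rightarrow>
       (real ^ 'n::{finite,linorder} \<Rightarrow> ereal) set" where
  "herz_morrey \<alpha> lam p q =
     {f \<in> mixed_Lebesgue_loc (- {0}) q. herz_morrey_norm \<alpha> lam p q f < \<infinity>}"

definition ball_average :: "(real ^ 'n \<Rightarrow> real) \<Rightarrow> real ^ 'n \<Rightarrow> real \<Rightarrow> real" where
  "ball_average b x r = (LINT y:cball x r|lebesgue. b y) / measure lebesgue (cball x r)"

definition BMO_seminorm :: "(real ^ 'n \<Rightarrow> real) \<Rightarrow> ennreal" where
  "BMO_seminorm b =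
     (SUP (x, r) \<in> UNIV \<times> {0<..}.
        (\<integral>\<^sup>+ y\<in>cball x r. ennreal \<bar>b y - ball_average b x r\<bar> \<partial>lebesgue)
          / emeasure lebesgue (cball x r))"

definition BMO :: "(real ^ 'n \<Rightarrow> real) set" where
  "BMO = {b. (\<forall>K. compact K \<longrightarrow> set_integrable lebesgue K b) \<and> BMO_seminorm b < \<infinity>}"

definition maximal_commutator ::
    "(real ^ 'n \<Rightarrow> real) \<Rightarrow> (real ^ 'n \<Rightarrow> ereal) \<Rightarrow> real ^ 'n \<Rightarrow> ereal" where
  "maximal_commutator b f x =
     enn2ereal (SUP r \<in> {0<..}.
       (\<integral>\<^sup>+ y\<in>cball x r. (ennreal \<bar>b x - b y\<bar> * e2ennreal \<bar>f y\<bar>) \<partial>lebesgue)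
         / emeasure lebesgue (cball x r))"

definition bounded_operator_on ::
    "('a \<Rightarrow> ereal) set \<Rightarrow> (('a \<Rightarrow> ereal) \<Rightarrow> ennreal) \<Rightarrow> (('a \<Rightarrow> ereal) \<Rightarrow> 'a \<Rightarrow> ereal) \<Rightarrow> bool" where
  "bounded_operator_on X N T \<longleftrightarrow>
     (\<exists>C::real. \<forall>f\<in>X. T f \<in> X \<and> N (T f) \<le> ennreal C * N f)"

end

(*
  No John-Nirenberg inequality is needed: boundedness of M_b on the mixed Lebesgue space itself
  supplies the two oscillation estimates.  With B_k the dyadic balls, m_k the mean of b on B_k and
  sigma the sum of the 1/q_i:
  - for x in B_k, |b(x) - m_k| is at most 2^n M_b(chi_{B_k})(x) plus the BMO seminorm;
  - averaging |b(y) - m_j| <= |b(x) - b(y)| + |b(x) - m_j| over x in B_j bounds the integral of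
    |b - m_j| h over B_j by C 2^{j (n - sigma)} times the norm of h.
  For x in A_k, the part of f on the annuli A_{k-1}, A_k, A_{k+1} is controlled by boundedness of
  M_b, and a ball around x that meets another A_j has radius at least 2^{max(j,k) - 2}.  This
  dominates the norm of (M_b f) chi_k by a convolution of the norms of f chi_j with a kernel that
  decays geometrically, up to a linear factor from |m_j - m_k| <= C |j - k|; the conditions on
  alpha make the kernel summable after inserting the weights 2^{k alpha} and 2^{k0 lambda}.
*)

theory Submission
  imports Defs
begin

section \<open>Powers on the extended half-line and iterated integrals\<close>

text \<open>The mixed norm is estimated through a quasi-triangle inequality, whose constant grows
  with each splitting, so an infinite sum over annuli cannot be pulled out of it term by term. The
  sum is therefore taken at a fixed point x of A_k: a distant annulus A_j contributes a number,
  depending on j, k and the norm of f on A_j, times \<open>M (indicator (B k)) x + 1\<close>, a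
  factor common to all j. What remains to be normed is a bounded number of functions. Two features
  of the setting add work. A Lebesgue measurable function may have nonmeasurable slices, so norm
  estimates are proved for Borel functions and carried over along null sets. And a Herz-Morrey
  function is only locally in the mixed Lebesgue space off the origin, so measurability of M_b f has
  to be obtained from truncations to compact shells. The gap left by the conditions on \<alpha> is
  cut in three: one third absorbs the linear factor, one pays for replacing a sum over shifts by a
  supremum, and one makes the remaining series converge.\<close>

lemma ennpow_0 [simp]: "ennpow 0 p = 0"
  by (simp add: ennpow_def)

lemma ennpow_top [simp]: "ennpow top p = top"
  by (simp add: ennpow_def)

lemma ennpow_exp_1 [simp]: "ennpow a 1 = a"
  by (cases a) (auto simp: ennpow_def)

lemma ennpow_ennreal: "0 \<le> c \<Longrightarrow> ennpow (ennreal c) p = ennreal (c powr p)"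
  by (simp add: ennpow_def)

lemma ennpow_mono:
  assumes "a \<le> b" "0 \<le> p"
  shows "ennpow a p \<le> ennpow b p"
  using assms
  by (cases a; cases b)
     (auto simp: ennpow_def top_unique intro!: ennreal_leI powr_mono2)

lemma ennpow_mult:
  assumes "0 < p"
  shows "ennpow (a * b) p = ennpow a p * ennpow b p"
proof (cases a; cases b)
  fix r s :: real
  assume "a = ennreal r" "0 \<le> r" "b = ennreal s" "0 \<le> s"
  then show ?thesis
    by (simp add: ennpow_ennreal powr_mult flip: ennreal_mult)
next
  fix r :: real
  assume "a = ennreal r" "0 \<le> r" "b = top"
  then show ?thesis
    by (cases "r = 0") (auto simp: ennpow_def ennreal_mult_top ennreal_mult_eq_top_iff powr_def)
next
  fix r :: real
  assume "b = ennreal r" "0 \<le> r" "a = top"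
  then show ?thesis
    by (cases "r = 0") (auto simp: ennpow_def ennreal_top_mult ennreal_mult_eq_top_iff powr_def)
qed (auto simp: ennpow_def)

lemma ennpow_ennpow: "ennpow (ennpow a p) r = ennpow a (p * r)"
  by (cases a) (auto simp: ennpow_def powr_powr)

text \<open>The sum is at most twice the maximum. This treats exponents above and below 1 alike;
  both occur among the ratios of consecutive exponents in the mixed norm.\<close>

lemma ennpow_add_le:
  assumes "0 < p"
  shows "ennpow (a + b) p \<le> ennreal (2 powr p) * (ennpow a p + ennpow b p)"
proof -
  have "ennpow (a + b) p \<le> ennpow (ennreal 2 * max a b) p"
  proof (rule ennpow_mono)
    have "a + b \<le> max a b + max a b"
      by (intro add_mono) auto
    then show "a + b \<le> ennreal 2 * max a b"
      by (metis ennreal_numeral mult_2 zero_le_numeral)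
  qed (use assms in auto)
  also have "\<dots> = ennreal (2 powr p) * ennpow (max a b) p"
    using assms ennpow_ennreal[of 2 p] by (simp add: ennpow_mult)
  also have "\<dots> \<le> ennreal (2 powr p) * (ennpow a p + ennpow b p)"
    by (intro mult_left_mono) (auto simp: max_def)
  finally show ?thesis .
qed

lemma ennpow_eq_0_iff [simp]: "ennpow a p = 0 \<longleftrightarrow> a = 0"
  by (cases a) (auto simp: ennpow_def)

lemma ennpow_eq_top_iff [simp]: "ennpow a p = top \<longleftrightarrow> a = top"
  by (cases a) (auto simp: ennpow_def)

lemma measurable_ennpow [measurable]:
  assumes [measurable]: "f \<in> borel_measurable M"
  shows "(\<lambda>x. ennpow (f x) p) \<in> borel_measurable M"
  unfolding ennpow_def by measurable

text \<open>Both sides are suprema of finite partial sums. In integral form the sums of the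
  Herz-Morrey norm become accessible to Tonelli's theorem and to reindexing by bijections.\<close>

lemma infsum_eq_nn_integral_count_space:
  fixes f :: "'a \<Rightarrow> ennreal"
  assumes "countable A"
  shows "infsum f A = (\<integral>\<^sup>+ x. f x \<partial>count_space A)"
proof -
  have SUP: "infsum f A = (SUP F\<in>{F. finite F \<and> F \<subseteq> A}. sum f F)"
    by (rule nonneg_infsum_complete) auto
  show ?thesis
  proof (rule antisym)
    show "infsum f A \<le> (\<integral>\<^sup>+ x. f x \<partial>count_space A)"
      unfolding SUP
    proof (rule SUP_least)
      fix F assume F: "F \<in> {F. finite F \<and> F \<subseteq> A}"
      then have "sum f F = (\<integral>\<^sup>+ x. f x \<partial>count_space F)"
        by (simp add: nn_integral_count_space_finite)
      also have "\<dots> = (\<integral>\<^sup>+ x. f x * indicator F x \<partial>count_space UNIV)"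
        by (simp add: nn_integral_count_space_indicator)
      also have "\<dots> \<le> (\<integral>\<^sup>+ x. f x * indicator A x \<partial>count_space UNIV)"
        using F by (intro nn_integral_mono) (auto simp: indicator_def)
      also have "\<dots> = (\<integral>\<^sup>+ x. f x \<partial>count_space A)"
        by (simp add: nn_integral_count_space_indicator)
      finally show "sum f F \<le> (\<integral>\<^sup>+ x. f x \<partial>count_space A)" .
    qed
  next
    show "(\<integral>\<^sup>+ x. f x \<partial>count_space A) \<le> infsum f A"
    proof (cases "finite A")
      case True
      then show ?thesis by (simp add: nn_integral_count_space_finite)
    next
      case False
      then have bij: "bij_betw (from_nat_into A) UNIV A"
        using assms by (intro bij_betw_from_nat_into) auto
      have "(\<integral>\<^sup>+ x. f x \<partial>count_space A) = (\<integral>\<^sup>+ n. f (from_nat_into A n) \<partial>count_space UNIV)"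
        by (rule nn_integral_bij_count_space[OF bij, symmetric])
      also have "\<dots> = (\<Sum>n. f (from_nat_into A n))"
        by (rule nn_integral_count_space_nat)
      also have "\<dots> \<le> infsum f A"
      proof (rule suminf_le_const)
        fix n
        have "(\<Sum>i<n. f (from_nat_into A i)) = sum f (from_nat_into A ` {..<n})"
          using bij by (subst sum.reindex) (auto simp: bij_betw_def inj_on_def)
        also have "\<dots> \<le> infsum f A"
          unfolding SUP using bij by (intro SUP_upper) (auto simp: bij_betw_def)
        finally show "(\<Sum>i<n. f (from_nat_into A i)) \<le> infsum f A" .
      qed auto
      finally show ?thesis .
    qed
  qed
qed

section \<open>Iterated integrals as Lebesgue integrals\<close>

lemma borel_measurable_vec_nth [measurable]:
  "(\<lambda>x :: real ^ 'n. x $ i) \<in> borel_measurable borel"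
  by (intro borel_measurable_continuous_onI continuous_intros)

lemma borel_measurable_vecI:
  fixes f :: "'a \<Rightarrow> real ^ 'n"
  assumes "\<And>i. (\<lambda>x. f x $ i) \<in> borel_measurable M"
  shows "f \<in> borel_measurable M"
  unfolding borel_measurable_euclidean_space[where f = f]
  using assms by (auto simp: Basis_vec_def inner_axis)

lemma borel_measurable_vec_upd [measurable]:
  assumes [measurable]: "f \<in> borel_measurable M" "g \<in> borel_measurable M"
  shows "(\<lambda>x. vec_upd (f x :: real ^ 'n) i (g x)) \<in> borel_measurable M"
proof (rule borel_measurable_vecI)
  fix j
  have "(\<lambda>x. if j = i then g x else f x $ j) \<in> borel_measurable M"
    by measurable
  then show "(\<lambda>x. vec_upd (f x) i (g x) $ j) \<in> borel_measurable M"
    by (simp add: vec_upd_def)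
qed

text \<open>The exponent-free companion of \<open>mixed_iter\<close>, with the same order of
  coordinates. It serves two ends: measuring the exceptional sets that successive slicing leaves
  over, and linking the mixed norm to the ordinary integral.\<close>

fun iter_integral :: "'n list \<Rightarrow> (real ^ 'n \<Rightarrow> ennreal) \<Rightarrow> real ^ 'n \<Rightarrow> ennreal" where
  "iter_integral [] g = g"
| "iter_integral (i # is) g = iter_integral is (\<lambda>x. \<integral>\<^sup>+ t. g (vec_upd x i t) \<partial>lborel)"

lemma borel_measurable_slice [measurable]:
  fixes g :: "real ^ 'n \<Rightarrow> ennreal"
  assumes [measurable]: "g \<in> borel_measurable borel"
  shows "(\<lambda>x. \<integral>\<^sup>+ t. g (vec_upd x i t) \<partial>lborel) \<in> borel_measurable borel"
  by measurable

lemma iter_integral_mono: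
  "(\<And>x. g x \<le> h x) \<Longrightarrow> iter_integral is g x \<le> iter_integral is h x"
proof (induction "is" arbitrary: g h)
  case (Cons i "is")
  show ?case
    unfolding iter_integral.simps by (intro Cons.IH nn_integral_mono Cons.prems)
qed simp

lemma iter_integral_cmult:
  fixes g :: "real ^ 'n \<Rightarrow> ennreal"
  assumes "g \<in> borel_measurable borel"
  shows "iter_integral is (\<lambda>x. c * g x) x = c * iter_integral is g x"
  using assms
proof (induction "is" arbitrary: g)
  case (Cons i "is")
  note [measurable] = Cons.prems
  show ?case
    by (simp add: nn_integral_cmult Cons.IH)
qed simp

text \<open>Coordinates outside \<open>is\<close> stay frozen at \<open>x\<close>, which keeps the
  claim inductive; each step is Tonelli's theorem for one more factor of the product
  measure.\<close>

lemma iter_integral_PiM: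
  fixes g :: "real ^ 'n \<Rightarrow> ennreal"
  assumes "g \<in> borel_measurable borel" "distinct is"
  shows "iter_integral is g x =
    (\<integral>\<^sup>+ w. g (\<chi> j. if j \<in> set is then w j else x $ j) \<partial>Pi\<^sub>M (set is) (\<lambda>_. lborel))"
  using assms
proof (induction "is" arbitrary: g)
  case Nil
  show ?case
    by (simp add: PiM_empty nn_integral_count_space_finite)
next
  case (Cons i "is")
  interpret product_sigma_finite "\<lambda>_ :: 'n. lborel :: real measure" ..
  note [measurable] = Cons.prems(1)
  have [measurable]: "(\<lambda>w. \<chi> j. if j \<in> I then w j else x $ j) \<in> borel_measurable (Pi\<^sub>M I (\<lambda>_. lborel))"
    for I :: "'n set"
  proof (rule borel_measurable_vecI)
    fix i
    show "(\<lambda>w. (\<chi> j. if j \<in> I then w j else x $ j) $ i) \<in> borel_measurable (Pi\<^sub>M I (\<lambda>_. lborel))"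
      by (cases "i \<in> I") auto
  qed
  have eq: "vec_upd (\<chi> j. if j \<in> set is then w j else x $ j) i t =
     (\<chi> j. if j \<in> set (i # is) then (w(i := t)) j else x $ j)" for w t
    using Cons.prems by (auto simp: vec_upd_def vec_eq_iff)
  have "iter_integral (i # is) g x =
    (\<integral>\<^sup>+ w. \<integral>\<^sup>+ t. g (\<chi> j. if j \<in> set (i # is) then (w(i := t)) j else x $ j) \<partial>lborel
       \<partial>Pi\<^sub>M (set is) (\<lambda>_. lborel))"
    using Cons.prems by (simp only: iter_integral.simps Cons.IH borel_measurable_slice distinct.simps eq)
  also have "\<dots> = (\<integral>\<^sup>+ w. g (\<chi> j. if j \<in> set (i # is) then w j else x $ j)
       \<partial>Pi\<^sub>M (set (i # is)) (\<lambda>_. lborel))"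
    unfolding list.set(2)
  proof (rule product_nn_integral_insert[symmetric])
    show "(\<lambda>w. g (\<chi> j. if j \<in> insert i (set is) then w j else x $ j))
      \<in> borel_measurable (Pi\<^sub>M (insert i (set is)) (\<lambda>_. lborel))"
      by measurable
  qed (use Cons.prems in auto)
  finally show ?case .
qed

text \<open>Lebesgue measure is determined by its values on boxes, and the product measure gives a
  box the product of its side lengths.\<close>

lemma lborel_eq_distr_PiM:
  "(lborel :: (real ^ 'n) measure) =
     distr (Pi\<^sub>M UNIV (\<lambda>_. lborel)) borel (\<lambda>w. \<chi> j. w j)"
proof (rule lborel_eqI)
  interpret product_sigma_finite "\<lambda>_ :: 'n. lborel :: real measure" ..
  have meas [measurable]: "(\<lambda>w. (\<chi> j. w j) :: real ^ 'n) \<in> borel_measurable (Pi\<^sub>M UNIV (\<lambda>_. lborel))"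
    by (rule borel_measurable_vecI) simp
  fix l u :: "real ^ 'n"
  assume le: "\<And>b. b \<in> Basis \<Longrightarrow> l \<bullet> b \<le> u \<bullet> b"
  then have le': "l $ i \<le> u $ i" for i
    by (force simp: Basis_vec_def inner_axis)
  have "(\<lambda>w. (\<chi> j. w j) :: real ^ 'n) -` box l u \<inter> space (Pi\<^sub>M UNIV (\<lambda>_. lborel)) =
     (\<Pi>\<^sub>E i\<in>UNIV. {l $ i<..<u $ i})"
    by (auto simp: mem_box_cart space_PiM PiE_def Pi_iff)
  then have "emeasure (distr (Pi\<^sub>M UNIV (\<lambda>_. lborel)) borel (\<lambda>w. \<chi> j. w j)) (box l u) =
     (\<Prod>i\<in>UNIV. emeasure lborel {l $ i<..<u $ i})"
    by (subst emeasure_distr) (auto simp: emeasure_PiM)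
  also have "\<dots> = ennreal (\<Prod>i\<in>UNIV. u $ i - l $ i)"
    using le' by (simp add: prod_ennreal)
  also have "(\<Prod>i\<in>UNIV. u $ i - l $ i) = (\<Prod>b\<in>Basis. (u - l) \<bullet> b)"
  proof -
    have "(\<Prod>b\<in>Basis. (u - l) \<bullet> b) = (\<Prod>b\<in>range (\<lambda>i. axis i (1::real)). (u - l) \<bullet> b)"
      by (rule prod.cong) (auto simp: Basis_vec_def)
    also have "\<dots> = (\<Prod>i\<in>UNIV. u $ i - l $ i)"
      by (subst prod.reindex) (auto simp: inj_on_def axis_eq_axis inner_axis)
    finally show ?thesis ..
  qed
  finally show "emeasure (distr (Pi\<^sub>M UNIV (\<lambda>_. lborel)) borel (\<lambda>w. \<chi> j. w j)) (box l u) =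
     (\<Prod>b\<in>Basis. (u - l) \<bullet> b)" .
qed simp

lemma iter_integral_eq_nn_integral:
  fixes g :: "real ^ 'n \<Rightarrow> ennreal"
  assumes [measurable]: "g \<in> borel_measurable borel" and "distinct is" "set is = UNIV"
  shows "iter_integral is g x = (\<integral>\<^sup>+ y. g y \<partial>lborel)"
proof -
  have [measurable]: "(\<lambda>w. (\<chi> j. w j) :: real ^ 'n) \<in> borel_measurable (Pi\<^sub>M UNIV (\<lambda>_. lborel))"
    by (rule borel_measurable_vecI) simp
  show ?thesis
    using assms
    by (subst lborel_eq_distr_PiM) (simp add: iter_integral_PiM nn_integral_distr)
qed

section \<open>The iterated mixed norm\<close>

lemma borel_measurable_mixed_slice [measurable]:
  fixes g :: "real ^ 'n \<Rightarrow> ennreal"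
  assumes [measurable]: "g \<in> borel_measurable borel"
  shows "(\<lambda>x. \<integral>\<^sup>+ t. ennpow (g (vec_upd x i t)) r \<partial>lebesgue) \<in> borel_measurable borel"
  unfolding nn_integral_completion by measurable

lemma mixed_iter_mono:
  assumes "\<And>x. g x \<le> h x" "0 < s" "\<And>i. 0 < q $ i"
  shows "mixed_iter q s is g x \<le> mixed_iter q s is h x"
  using assms
proof (induction "is" arbitrary: g h s)
  case Nil
  then show ?case by (auto intro!: ennpow_mono)
next
  case (Cons i "is")
  show ?case
    unfolding mixed_iter.simps
    by (intro Cons.IH nn_integral_mono ennpow_mono Cons.prems)
       (use Cons.prems in \<open>auto intro!: less_imp_le divide_pos_pos\<close>)
qed

lemma mixed_iter_cmult:
  assumes "g \<in> borel_measurable borel" "0 < s" "\<And>i. 0 < q $ i"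
  shows "mixed_iter q s is (\<lambda>x. c * g x) x = ennpow c (1 / s) * mixed_iter q s is g x"
  using assms
proof (induction "is" arbitrary: g c s)
  case Nil
  then show ?case by (simp add: ennpow_mult)
next
  case (Cons i "is")
  note [measurable] = Cons.prems(1)
  have "(\<lambda>x. \<integral>\<^sup>+ t. ennpow (c * g (vec_upd x i t)) (q $ i / s) \<partial>lebesgue) =
    (\<lambda>x. ennpow c (q $ i / s) * (\<integral>\<^sup>+ t. ennpow (g (vec_upd x i t)) (q $ i / s) \<partial>lebesgue))"
    using Cons.prems by (simp add: ennpow_mult nn_integral_completion nn_integral_cmult)
  then show ?case
    using Cons.prems(2) Cons.prems(3)[of i]
    by (simp add: Cons.IH[OF _ Cons.prems(3) Cons.prems(3)] ennpow_ennpow)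
qed

text \<open>The constant is fixed before \<open>g\<close> and \<open>h\<close>, which makes it
  uniform; each coordinate multiplies it by \<open>D\<close>, which equals 2^(1/s).\<close>

lemma mixed_iter_add_le:
  assumes "0 < s" "\<And>i. 0 < q $ i"
  shows "\<exists>C\<ge>0. \<forall>g\<in>borel_measurable borel. \<forall>h\<in>borel_measurable borel.
    mixed_iter q s is (\<lambda>x. g x + h x) x
      \<le> ennreal C * (mixed_iter q s is g x + mixed_iter q s is h x)"
  using assms(1)
proof (induction "is" arbitrary: s)
  case Nil
  then show ?case
    by (intro exI[of _ "2 powr (1 / s)"]) (auto intro!: ennpow_add_le)
next
  case (Cons i "is")
  obtain C where "C \<ge> 0" and C: "\<And>g h. g \<in> borel_measurable borel \<Longrightarrow> h \<in> borel_measurable borel \<Longrightarrow>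
    mixed_iter q (q $ i) is (\<lambda>x. g x + h x) x
      \<le> ennreal C * (mixed_iter q (q $ i) is g x + mixed_iter q (q $ i) is h x)"
    using Cons.IH[OF assms(2)] by blast
  define r where "r = q $ i / s"
  have r: "0 < r"
    using Cons.prems assms(2) by (simp add: r_def)
  define D where "D = (2 powr r) powr (1 / q $ i)"
  show ?case
  proof (intro exI conjI ballI)
    show "0 \<le> C * D"
      using \<open>C \<ge> 0\<close> by (simp add: D_def)
    fix g h :: "real ^ 'a \<Rightarrow> ennreal"
    assume [measurable]: "g \<in> borel_measurable borel" "h \<in> borel_measurable borel"
    define G where "G = (\<lambda>x. \<integral>\<^sup>+ t. ennpow (g (vec_upd x i t)) r \<partial>lebesgue)"
    define H where "H = (\<lambda>x. \<integral>\<^sup>+ t. ennpow (h (vec_upd x i t)) r \<partial>lebesgue)"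
    have [measurable]: "G \<in> borel_measurable borel" "H \<in> borel_measurable borel"
      by (simp_all add: G_def H_def)
    have "mixed_iter q s (i # is) (\<lambda>x. g x + h x) x \<le>
      mixed_iter q (q $ i) is (\<lambda>x. ennreal (2 powr r) * (G x + H x)) x"
      unfolding mixed_iter.simps r_def[symmetric]
    proof (rule mixed_iter_mono)
      fix x
      have "(\<integral>\<^sup>+ t. ennpow (g (vec_upd x i t) + h (vec_upd x i t)) r \<partial>lebesgue) \<le>
        (\<integral>\<^sup>+ t. ennreal (2 powr r) * (ennpow (g (vec_upd x i t)) r + ennpow (h (vec_upd x i t)) r) \<partial>lebesgue)"
        by (intro nn_integral_mono ennpow_add_le r)
      also have "\<dots> = ennreal (2 powr r) * (G x + H x)"
        by (simp add: nn_integral_completion nn_integral_cmult nn_integral_add G_def H_def)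
      finally show "(\<integral>\<^sup>+ t. ennpow (g (vec_upd x i t) + h (vec_upd x i t)) r \<partial>lebesgue) \<le> \<dots>" .
    qed (use assms in auto)
    also have "\<dots> = ennreal D * mixed_iter q (q $ i) is (\<lambda>x. G x + H x) x"
      using assms(2) by (subst mixed_iter_cmult) (auto simp: D_def ennpow_ennreal)
    also have "\<dots> \<le> ennreal D * (ennreal C *
        (mixed_iter q (q $ i) is G x + mixed_iter q (q $ i) is H x))"
      by (intro mult_left_mono C) auto
    also have "\<dots> = ennreal (C * D) * (mixed_iter q s (i # is) g x + mixed_iter q s (i # is) h x)"
      using \<open>C \<ge> 0\<close> by (simp add: G_def H_def r_def D_def ennreal_mult mult_ac)
    finally show "mixed_iter q s (i # is) (\<lambda>x. g x + h x) x \<le> \<dots>" .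
  qed
qed

text \<open>Null sets survive slicing: the points whose slice meets \<open>N\<close> in positive
  measure form a set that is null for the remaining coordinates. \<open>g\<close> and
  \<open>h\<close> are arbitrary, so a Lebesgue measurable function, possibly with bad slices, can
  be replaced by a Borel one.\<close>

lemma mixed_iter_cong_null:
  assumes "N \<in> sets borel" "iter_integral is (indicator N) x = 0"
    and "\<And>x. x \<notin> N \<Longrightarrow> g x = h x"
  shows "mixed_iter q s is g x = mixed_iter q s is h x"
  using assms
proof (induction "is" arbitrary: N g h s)
  case Nil
  then show ?case by (auto simp: indicator_def)
next
  case (Cons i "is")
  note [measurable] = Cons.prems(1)
  define u :: "real ^ 'a \<Rightarrow> ennreal" where
    "u = (\<lambda>x. \<integral>\<^sup>+ t. indicator N (vec_upd x i t) \<partial>lborel)"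
  have [measurable]: "u \<in> borel_measurable borel"
    unfolding u_def by measurable
  define N' where "N' = {x. u x \<noteq> 0}"
  \<comment> \<open>\<open>top * u\<close> is infinite on \<open>N'\<close>, while a factor
    \<open>top\<close> leaves a vanishing integral at 0.\<close>
  have "iter_integral is (indicator N') x \<le> iter_integral is (\<lambda>x. top * u x) x"
    by (rule iter_integral_mono) (auto simp: N'_def indicator_def ennreal_top_mult)
  also have "\<dots> = 0"
    using Cons.prems(2) by (simp add: iter_integral_cmult u_def)
  finally have 0: "iter_integral is (indicator N') x = 0" by simp
  have slice: "(\<integral>\<^sup>+ t. ennpow (g (vec_upd x i t)) (q $ i / s) \<partial>lebesgue) =
      (\<integral>\<^sup>+ t. ennpow (h (vec_upd x i t)) (q $ i / s) \<partial>lebesgue)" if "x \<notin> N'" for x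
  proof -
    have "(\<integral>\<^sup>+ t. indicator N (vec_upd x i t) \<partial>lborel) = (0 :: ennreal)"
      using that by (simp add: N'_def u_def)
    then have "AE t in lborel. (indicator N (vec_upd x i t) :: ennreal) = 0"
      by (subst (asm) nn_integral_0_iff_AE) auto
    then have "AE t in lborel. ennpow (g (vec_upd x i t)) (q $ i / s) = ennpow (h (vec_upd x i t)) (q $ i / s)"
      by eventually_elim (use Cons.prems(3) in \<open>auto simp: indicator_def split: if_splits\<close>)
    then show ?thesis
      unfolding nn_integral_completion by (rule nn_integral_cong_AE)
  qed
  show ?case
    unfolding mixed_iter.simps
    by (rule Cons.IH[OF _ 0 slice]) (auto simp: N'_def)
qed

text \<open>Hoelder's inequality against 1 on [-R, R], up to a factor 2. It follows from cutting h
  at a height A: below it h is at most A, above it at most A^(1-r) h^r.\<close>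

lemma nn_integral_le_ennpow_nn_integral:
  fixes h :: "real \<Rightarrow> ennreal"
  assumes [measurable]: "h \<in> borel_measurable borel" and "0 < R" "1 < r"
    and supp: "\<And>t. \<bar>t\<bar> > R \<Longrightarrow> h t = 0"
  shows "(\<integral>\<^sup>+ t. h t \<partial>lborel) \<le>
    ennreal (2 * (2 * R) powr (1 - 1 / r)) * ennpow (\<integral>\<^sup>+ t. ennpow (h t) r \<partial>lborel) (1 / r)"
proof (cases "\<integral>\<^sup>+ t. ennpow (h t) r \<partial>lborel")
  case top
  then show ?thesis
    using assms by (simp add: ennreal_mult_top)
next
  case (real I)
  show ?thesis
  proof (cases "I = 0")
    case True
    then have "AE t in lborel. ennpow (h t) r = 0"
      using real by (subst nn_integral_0_iff_AE[symmetric]) auto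
    then have "AE t in lborel. h t = 0"
      by simp
    then have "(\<integral>\<^sup>+ t. h t \<partial>lborel) = 0"
      by (subst nn_integral_0_iff_AE) auto
    then show ?thesis by simp
  next
    case False
    with real have "I > 0" by simp
    \<comment> \<open>The height that balances the two parts of the majorant: each then integrates
      to \<open>A * (2 * R)\<close>, whence the factor 2.\<close>
    define A where "A = (I / (2 * R)) powr (1 / r)"
    have "A > 0"
      using \<open>I > 0\<close> \<open>0 < R\<close> by (simp add: A_def)
    have le: "h t \<le> ennreal A * indicator {-R..R} t + ennreal (A powr (1 - r)) * ennpow (h t) r" for t
    proof (cases "\<bar>t\<bar> > R")
      case True
      then show ?thesis by (simp add: supp)
    next
      case inside: False
      show ?thesis
      proof (cases "h t")
        case top
        then show ?thesis
          using \<open>A > 0\<close> by (simp add: ennreal_mult_top)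
      next
        case (real y)
        have "y \<le> A + A powr (1 - r) * y powr r"
        proof (cases "y \<le> A")
          case False
          then have "1 * y \<le> (y / A) powr (r - 1) * y"
            using \<open>A > 0\<close> \<open>1 < r\<close> by (intro mult_right_mono ge_one_powr_ge_zero) (auto simp: field_simps)
          also have "\<dots> = A powr (1 - r) * y powr r"
            using \<open>A > 0\<close> False by (simp add: powr_divide powr_diff field_simps)
          finally show ?thesis
            using \<open>A > 0\<close> by simp
        qed (use \<open>A > 0\<close> in \<open>simp add: add_increasing2\<close>)
        then show ?thesis
          using real inside \<open>A > 0\<close>
          by (auto simp: ennpow_ennreal indicator_def simp flip: ennreal_mult ennreal_plus intro!: ennreal_leI)
      qed
    qed
    have "(\<integral>\<^sup>+ t. h t \<partial>lborel) \<le>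
      (\<integral>\<^sup>+ t. ennreal A * indicator {-R..R} t + ennreal (A powr (1 - r)) * ennpow (h t) r \<partial>lborel)"
      by (intro nn_integral_mono le)
    also have "\<dots> = ennreal A * ennreal (2 * R) + ennreal (A powr (1 - r)) * ennreal I"
      using \<open>0 < R\<close> by (simp add: nn_integral_add nn_integral_cmult real)
    also have "\<dots> = ennreal (A * (2 * R) + A powr (1 - r) * I)"
      using \<open>A > 0\<close> \<open>I > 0\<close> \<open>0 < R\<close> by (simp flip: ennreal_mult ennreal_plus)
    also have "A powr (1 - r) * I = A * (2 * R)"
    proof -
      have "A powr r = I / (2 * R)"
        using \<open>I > 0\<close> \<open>0 < R\<close> \<open>1 < r\<close> by (simp add: A_def powr_powr)
      then show ?thesis
        using \<open>A > 0\<close> \<open>I > 0\<close> \<open>0 < R\<close> by (simp add: powr_diff field_simps)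
    qed
    also have "A * (2 * R) + A * (2 * R) = (2 * (2 * R) powr (1 - 1 / r)) * I powr (1 / r)"
      using \<open>I > 0\<close> \<open>0 < R\<close> by (simp add: A_def powr_divide powr_diff field_simps)
    finally show ?thesis
      using \<open>I > 0\<close> \<open>0 < R\<close> real by (simp add: ennpow_ennreal ennreal_mult)
  qed
qed

text \<open>For each coordinate the one-dimensional bound is applied to g^(1/s) with exponent q_i;
  its q_i-th power g^(q_i/s) is the integrand of \<open>mixed_iter\<close>. Integrating out one
  coordinate preserves vanishing outside the cube in the others, so the induction continues.\<close>

lemma iter_integral_le_mixed_iter:
  fixes g :: "real ^ 'n \<Rightarrow> ennreal"
  assumes "g \<in> borel_measurable borel" "0 < R" "0 < s" "\<And>i. 1 < q $ i" "distinct is"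
    and "\<And>x i. i \<in> set is \<Longrightarrow> \<bar>x $ i\<bar> > R \<Longrightarrow> g x = 0"
  shows "iter_integral is (\<lambda>x. ennpow (g x) (1 / s)) x \<le>
    ennreal (2 ^ length is * (2 * R) powr (\<Sum>i\<in>set is. 1 - 1 / q $ i)) * mixed_iter q s is g x"
  using assms
proof (induction "is" arbitrary: g s)
  case Nil
  then show ?case by simp
next
  case (Cons i "is")
  note [measurable] = Cons.prems(1)
  have q: "1 < q $ i" by fact
  define G where "G = (\<lambda>x. \<integral>\<^sup>+ t. ennpow (g (vec_upd x i t)) (q $ i / s) \<partial>lebesgue)"
  have [measurable]: "G \<in> borel_measurable borel"
    by (simp add: G_def)
  define c where "c = 2 * (2 * R) powr (1 - 1 / q $ i)"
  have "iter_integral (i # is) (\<lambda>x. ennpow (g x) (1 / s)) x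
    \<le> iter_integral is (\<lambda>x. ennreal c * ennpow (G x) (1 / q $ i)) x"
    unfolding iter_integral.simps
  proof (rule iter_integral_mono)
    fix x
    show "(\<integral>\<^sup>+ t. ennpow (g (vec_upd x i t)) (1 / s) \<partial>lborel) \<le> ennreal c * ennpow (G x) (1 / q $ i)"
    proof -
      have "g (vec_upd x i t) = 0" if "R < \<bar>t\<bar>" for t
        using that by (intro Cons.prems(6)[of i]) (auto simp: vec_upd_def)
      then show ?thesis
        using nn_integral_le_ennpow_nn_integral[of "\<lambda>t. ennpow (g (vec_upd x i t)) (1 / s)" R "q $ i"]
          q Cons.prems(2)
        by (simp add: G_def c_def ennpow_ennpow nn_integral_completion)
    qed
  qed
  also have "\<dots> = ennreal c * iter_integral is (\<lambda>x. ennpow (G x) (1 / q $ i)) x"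
    by (rule iter_integral_cmult) measurable
  also have "\<dots> \<le> ennreal c * (ennreal (2 ^ length is * (2 * R) powr (\<Sum>i\<in>set is. 1 - 1 / q $ i)) *
      mixed_iter q (q $ i) is G x)"
  proof (intro mult_left_mono Cons.IH)
    fix x j
    assume j: "j \<in> set is" "R < \<bar>x $ j\<bar>"
    then have "g (vec_upd x i t) = 0" for t
      using Cons.prems(5) by (intro Cons.prems(6)[of j]) (auto simp: vec_upd_def)
    then show "G x = 0"
      by (simp add: G_def)
  next
    show "0 < q $ i"
      using q by simp
  qed (use Cons.prems in auto)
  also have "\<dots> = ennreal (2 ^ length (i # is) * (2 * R) powr (\<Sum>i\<in>set (i # is). 1 - 1 / q $ i)) *
      mixed_iter q s (i # is) g x"
    using Cons.prems(2,5)
    by (simp add: G_def c_def powr_add ennreal_mult mult_ac)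
  finally show ?case .
qed

text \<open>The factor \<open>K\<close> is carried along because integrating out one coordinate
  returns a multiple of the indicator of a cube in the remaining ones.\<close>

lemma mixed_iter_indicator_cube:
  fixes q :: "real ^ 'n"
  assumes "0 < R" "0 < s" "\<And>i. 0 < q $ i" "distinct is"
  shows "mixed_iter q s is (\<lambda>x. K * indicator {x. \<forall>i\<in>set is. \<bar>x $ i\<bar> \<le> R} x) x =
    ennpow K (1 / s) * ennreal ((2 * R) powr (\<Sum>i\<in>set is. 1 / q $ i))"
  using assms
proof (induction "is" arbitrary: K s)
  case Nil
  then show ?case by simp
next
  case (Cons i "is")
  have q: "0 < q $ i" by fact
  have eq: "(\<integral>\<^sup>+ t. ennpow (K * indicator {x. \<forall>i\<in>set (i # is). \<bar>x $ i\<bar> \<le> R} (vec_upd x i t)) (q $ i / s) \<partial>lebesgue)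
    = (ennpow K (q $ i / s) * ennreal (2 * R)) * indicator {x. \<forall>i\<in>set is. \<bar>x $ i\<bar> \<le> R} x" for x
  proof -
    have "ennpow (K * indicator {x. \<forall>i\<in>set (i # is). \<bar>x $ i\<bar> \<le> R} (vec_upd x i t)) (q $ i / s) =
      (ennpow K (q $ i / s) * indicator {x. \<forall>i\<in>set is. \<bar>x $ i\<bar> \<le> R} x) * indicator {-R..R} t" for t
      using Cons.prems(4) by (auto simp: vec_upd_def indicator_def)
    then have "(\<integral>\<^sup>+ t. ennpow (K * indicator {x. \<forall>i\<in>set (i # is). \<bar>x $ i\<bar> \<le> R} (vec_upd x i t)) (q $ i / s) \<partial>lebesgue) =
      (\<integral>\<^sup>+ t. (ennpow K (q $ i / s) * indicator {x. \<forall>i\<in>set is. \<bar>x $ i\<bar> \<le> R} x) * indicator {-R..R} t \<partial>lborel)"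
      unfolding nn_integral_completion by (intro nn_integral_cong)
    also have "\<dots> = (ennpow K (q $ i / s) * indicator {x. \<forall>i\<in>set is. \<bar>x $ i\<bar> \<le> R} x) * emeasure lborel {-R..R}"
      by (rule nn_integral_cmult_indicator) simp
    finally show ?thesis
      using Cons.prems(1) by (simp add: mult_ac)
  qed
  have pow: "ennpow (ennpow K (q $ i / s) * ennreal (2 * R)) (1 / q $ i) =
      ennpow K (1 / s) * ennreal ((2 * R) powr (1 / q $ i))"
    using q Cons.prems(1) by (simp add: ennpow_mult ennpow_ennpow ennpow_ennreal)
  have "mixed_iter q s (i # is) (\<lambda>x. K * indicator {x. \<forall>i\<in>set (i # is). \<bar>x $ i\<bar> \<le> R} x) x =
      ennpow K (1 / s) * ennreal ((2 * R) powr (1 / q $ i)) *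
        ennreal ((2 * R) powr (\<Sum>i\<in>set is. 1 / q $ i))"
    unfolding mixed_iter.simps eq pow[symmetric]
    by (rule Cons.IH) (use Cons.prems in auto)
  also have "\<dots> = ennpow K (1 / s) * ennreal ((2 * R) powr (\<Sum>i\<in>set (i # is). 1 / q $ i))"
    using Cons.prems(4) by (simp add: powr_add ennreal_mult mult.assoc)
  finally show ?case .
qed

section \<open>The mixed norm of a Lebesgue measurable function\<close>

locale mixed_exponents =
  fixes q :: "real ^ 'n::{finite,linorder}"
  assumes exponent_gt_1: "1 < q $ i"
begin

definition N :: "(real ^ 'n::{finite,linorder} \<Rightarrow> ennreal) \<Rightarrow> ennreal" where
  "N h = mixed_iter q 1 (sorted_list_of_set UNIV) h 0"

definition \<sigma> :: real where
  "\<sigma> = (\<Sum>i\<in>UNIV. 1 / q $ i)"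

lemma exponent_pos: "0 < q $ i"
  using exponent_gt_1[of i] by simp

lemma mixed_norm_eq_N: "mixed_norm q f = N (\<lambda>x. e2ennreal \<bar>f x\<bar>)"
  by (simp add: mixed_norm_def N_def)

lemma N_mono: "(\<And>x. g x \<le> h x) \<Longrightarrow> N g \<le> N h"
  unfolding N_def by (intro mixed_iter_mono exponent_pos) auto

lemma N_cong_AE:
  assumes "AE x in lebesgue. g x = h x"
  shows "N g = N h"
proof -
  have "AE x in lborel. g x = h x"
    using assms by (simp add: AE_completion_iff)
  then obtain S where S: "{x \<in> space lborel. g x \<noteq> h x} \<subseteq> S" "S \<in> null_sets lborel"
    by (auto elim: AE_E simp: null_sets_def)
  show ?thesis
    unfolding N_def
  proof (rule mixed_iter_cong_null)
    show "S \<in> sets borel"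
      using S by auto
    then show "iter_integral (sorted_list_of_set UNIV) (indicator S) 0 = 0"
      using S by (subst iter_integral_eq_nn_integral) auto
    show "\<And>x. x \<notin> S \<Longrightarrow> g x = h x"
      using S by auto
  qed
qed

lemma lebesgue_ex_borel:
  fixes g :: "real ^ 'n::{finite,linorder} \<Rightarrow> ennreal"
  assumes "g \<in> borel_measurable lebesgue"
  obtains g' where "g' \<in> borel_measurable borel" "AE x in lebesgue. g x = g' x"
  using completion_ex_borel_measurable[OF assms] by (auto simp: AE_completion_iff)

lemma N_cmult:
  assumes "g \<in> borel_measurable lebesgue"
  shows "N (\<lambda>x. c * g x) = c * N g"
proof -
  obtain g' where g': "g' \<in> borel_measurable borel" "AE x in lebesgue. g x = g' x"
    using lebesgue_ex_borel[OF assms] .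
  have "N (\<lambda>x. c * g x) = N (\<lambda>x. c * g' x)" "N g = N g'"
    by (rule N_cong_AE; use g'(2) in eventually_elim; simp)+
  then show ?thesis
    using g'(1) exponent_pos by (simp add: N_def mixed_iter_cmult)
qed

lemma N_zero [simp]: "N (\<lambda>x. 0) = 0"
  using N_cmult[of "\<lambda>_. 0" 0] by simp

lemma N_add_le:
  obtains C where "C \<ge> 0"
    "\<And>g h. g \<in> borel_measurable lebesgue \<Longrightarrow> h \<in> borel_measurable lebesgue \<Longrightarrow>
      N (\<lambda>x. g x + h x) \<le> ennreal C * (N g + N h)"
proof -
  obtain C where "C \<ge> 0" and C: "\<And>g h. g \<in> borel_measurable borel \<Longrightarrow> h \<in> borel_measurable borel \<Longrightarrow>
    mixed_iter q 1 (sorted_list_of_set UNIV) (\<lambda>x. g x + h x) 0 \<le>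
      ennreal C * (mixed_iter q 1 (sorted_list_of_set UNIV) g 0 + mixed_iter q 1 (sorted_list_of_set UNIV) h 0)"
    using mixed_iter_add_le[OF zero_less_one exponent_pos, of "sorted_list_of_set UNIV" 0] by blast
  have "N (\<lambda>x. g x + h x) \<le> ennreal C * (N g + N h)"
    if gh: "g \<in> borel_measurable lebesgue" "h \<in> borel_measurable lebesgue" for g h
  proof -
    obtain g' where g': "g' \<in> borel_measurable borel" "AE x in lebesgue. g x = g' x"
      using lebesgue_ex_borel[OF gh(1)] .
    obtain h' where h': "h' \<in> borel_measurable borel" "AE x in lebesgue. h x = h' x"
      using lebesgue_ex_borel[OF gh(2)] .
    have "N (\<lambda>x. g x + h x) = N (\<lambda>x. g' x + h' x)"
      by (rule N_cong_AE, use g'(2) h'(2) in eventually_elim) simp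
    moreover have "N g = N g'" "N h = N h'"
      by (intro N_cong_AE g' h')+
    ultimately show ?thesis
      using C[OF g'(1) h'(1)] by (simp add: N_def)
  qed
  with \<open>C \<ge> 0\<close> that show ?thesis by blast
qed

lemma N_indicator_cball_le:
  assumes "0 < R"
  shows "N (indicator (cball 0 R)) \<le> ennreal ((2 * R) powr \<sigma>)"
proof -
  have "N (indicator (cball 0 R)) \<le> N (\<lambda>x. 1 * indicator {x. \<forall>i\<in>set (sorted_list_of_set UNIV). \<bar>x $ i\<bar> \<le> R} x)"
    by (rule N_mono) (auto simp: indicator_def intro: order_trans[OF component_le_norm_cart])
  also have "\<dots> = ennreal ((2 * R) powr \<sigma>)"
    unfolding N_def using assms exponent_pos
    by (subst mixed_iter_indicator_cube) (auto simp: \<sigma>_def)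
  finally show ?thesis .
qed

text \<open>Hoelder's inequality on the cube around the ball: \<open>CARD('n) - \<sigma>\<close> is
  the sum of the dual reciprocals 1 - 1/q_i, and 2^n collects the factor 2 lost in each
  coordinate.\<close>

lemma nn_integral_le_N:
  assumes "h \<in> borel_measurable lebesgue" "0 < R" "\<And>x. x \<notin> cball 0 R \<Longrightarrow> h x = 0"
  shows "(\<integral>\<^sup>+ x. h x \<partial>lebesgue) \<le> ennreal (2 ^ CARD('n) * (2 * R) powr (CARD('n) - \<sigma>)) * N h"
proof -
  obtain h0 where h0: "h0 \<in> borel_measurable borel" "AE x in lebesgue. h x = h0 x"
    using lebesgue_ex_borel[OF assms(1)] .
  note [measurable] = h0(1)
  \<comment> \<open>The Borel representative agrees with \<open>h\<close> only almost everywhere;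
    the cutoff restores vanishing at every point outside the cube, as
    \<open>iter_integral_le_mixed_iter\<close> demands.\<close>
  define h' where "h' = (\<lambda>x. h0 x * indicator (cball 0 R) x)"
  have [measurable]: "h' \<in> borel_measurable borel"
    unfolding h'_def by (intro borel_measurable_times_ennreal borel_measurable_indicator h0) auto
  have AE: "AE x in lebesgue. h x = h' x"
    using h0(2) by eventually_elim (use assms(3) in \<open>auto simp: h'_def indicator_def\<close>)
  have 0: "h' x = 0" if "R < \<bar>x $ i\<bar>" for x i
    using that component_le_norm_cart[of x i] by (auto simp: h'_def indicator_def)
  have "(\<integral>\<^sup>+ x. h x \<partial>lebesgue) = (\<integral>\<^sup>+ x. h' x \<partial>lebesgue)"
    by (rule nn_integral_cong_AE[OF AE])
  also have "\<dots> = (\<integral>\<^sup>+ x. h' x \<partial>lborel)"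
    by (rule nn_integral_completion)
  also have "\<dots> = iter_integral (sorted_list_of_set UNIV) (\<lambda>x. ennpow (h' x) (1 / 1)) 0"
    by (subst iter_integral_eq_nn_integral) auto
  also have "\<dots> \<le> ennreal (2 ^ length (sorted_list_of_set (UNIV :: 'n set)) *
      (2 * R) powr (\<Sum>i\<in>set (sorted_list_of_set UNIV). 1 - 1 / q $ i)) *
      mixed_iter q 1 (sorted_list_of_set UNIV) h' 0"
    by (rule iter_integral_le_mixed_iter) (use assms exponent_gt_1 0 in auto)
  also have "\<dots> = ennreal (2 ^ CARD('n) * (2 * R) powr (CARD('n) - \<sigma>)) * N h'"
    by (simp add: N_def \<sigma>_def sum_subtractf)
  also have "N h' = N h"
    by (rule N_cong_AE[symmetric, OF AE])
  finally show ?thesis .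
qed

lemma N_sum_finite:
  assumes "finite I" "\<And>i. i \<in> I \<Longrightarrow> g i \<in> borel_measurable lebesgue" "\<And>i. i \<in> I \<Longrightarrow> N (g i) < \<infinity>"
  shows "N (\<lambda>x. \<Sum>i\<in>I. g i x) < \<infinity>"
  using assms
proof (induction I rule: finite_induct)
  case (insert i I)
  obtain C where C: "C \<ge> 0"
    "\<And>g h. g \<in> borel_measurable lebesgue \<Longrightarrow> h \<in> borel_measurable lebesgue \<Longrightarrow>
      N (\<lambda>x. g x + h x) \<le> ennreal C * (N g + N h)"
    using N_add_le by blast
  have "N (\<lambda>x. \<Sum>i\<in>insert i I. g i x) \<le> ennreal C * (N (g i) + N (\<lambda>x. \<Sum>i\<in>I. g i x))"
    using insert by (simp add: C(2))
  also have "\<dots> < \<infinity>"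
    using insert by (simp add: ennreal_mult_less_top)
  finally show ?case .
qed simp

end

section \<open>The maximal commutator on nonnegative functions\<close>

definition maximal_commutator_enn ::
    "(real ^ 'n \<Rightarrow> real) \<Rightarrow> (real ^ 'n \<Rightarrow> ennreal) \<Rightarrow> real ^ 'n \<Rightarrow> ennreal" where
  "maximal_commutator_enn b h x =
     (SUP r \<in> {0<..}.
       (\<integral>\<^sup>+ y\<in>cball x r. (ennreal \<bar>b x - b y\<bar> * h y) \<partial>lebesgue)
         / emeasure lebesgue (cball x r))"

lemma abs_maximal_commutator:
  "e2ennreal \<bar>maximal_commutator b f x\<bar> = maximal_commutator_enn b (\<lambda>y. e2ennreal \<bar>f y\<bar>) x"
  by (simp add: maximal_commutator_def maximal_commutator_enn_def)

lemma maximal_commutator_enn_cong_AE: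
  assumes "AE y in lebesgue. g y = h y"
  shows "maximal_commutator_enn b g x = maximal_commutator_enn b h x"
proof -
  have "(\<integral>\<^sup>+ y\<in>cball x r. (ennreal \<bar>b x - b y\<bar> * g y) \<partial>lebesgue) =
      (\<integral>\<^sup>+ y\<in>cball x r. (ennreal \<bar>b x - b y\<bar> * h y) \<partial>lebesgue)" for r
    by (rule nn_integral_cong_AE, use assms in eventually_elim) simp
  then show ?thesis
    by (simp add: maximal_commutator_enn_def)
qed

text \<open>Monotone convergence for each radius, after which the suprema over radii and over
  \<open>i\<close> commute. It yields measurability of the commutator for functions that are only
  locally in the mixed Lebesgue space.\<close>

lemma maximal_commutator_enn_SUP:
  fixes g :: "nat \<Rightarrow> real ^ 'n \<Rightarrow> ennreal"
  assumes b [measurable]: "b \<in> borel_measurable lebesgue"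
    and g [measurable]: "\<And>i. g i \<in> borel_measurable lebesgue" and "incseq g"
  shows "maximal_commutator_enn b (\<lambda>y. SUP i. g i y) x = (SUP i. maximal_commutator_enn b (g i) x)"
proof -
  have "(\<integral>\<^sup>+ y\<in>cball x r. (ennreal \<bar>b x - b y\<bar> * (SUP i. g i y)) \<partial>lebesgue) =
      (SUP i. \<integral>\<^sup>+ y\<in>cball x r. (ennreal \<bar>b x - b y\<bar> * g i y) \<partial>lebesgue)" for r
  proof -
    have "(\<integral>\<^sup>+ y\<in>cball x r. (ennreal \<bar>b x - b y\<bar> * (SUP i. g i y)) \<partial>lebesgue) =
      (\<integral>\<^sup>+ y. (SUP i. (ennreal \<bar>b x - b y\<bar> * g i y) * indicator (cball x r) y) \<partial>lebesgue)"
      by (simp only: SUP_mult_left_ennreal SUP_mult_right_ennreal)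
    also have "\<dots> = (SUP i. \<integral>\<^sup>+ y\<in>cball x r. (ennreal \<bar>b x - b y\<bar> * g i y) \<partial>lebesgue)"
      using \<open>incseq g\<close>
      by (intro nn_integral_monotone_convergence_SUP borel_measurable_times_ennreal
            borel_measurable_indicator)
         (auto simp: incseq_def le_fun_def intro!: mult_right_mono mult_left_mono)
    finally show ?thesis .
  qed
  then have "maximal_commutator_enn b (\<lambda>y. SUP i. g i y) x =
    (SUP r \<in> {0<..}. SUP i.
       (\<integral>\<^sup>+ y\<in>cball x r. (ennreal \<bar>b x - b y\<bar> * g i y) \<partial>lebesgue)
         / emeasure lebesgue (cball x r))"
    by (simp add: maximal_commutator_enn_def divide_ennreal_def SUP_mult_right_ennreal[symmetric])
  also have "\<dots> = (SUP i. maximal_commutator_enn b (g i) x)"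
    unfolding maximal_commutator_enn_def by (rule SUP_commute)
  finally show ?thesis .
qed

lemma emeasure_lebesgue_cball:
  fixes x :: "real ^ 'n"
  assumes "0 \<le> r"
  shows "emeasure lebesgue (cball x r) = ennreal (unit_ball_vol (CARD('n)) * r ^ CARD('n))"
  using emeasure_cball[OF assms, of x] by simp

text \<open>For \<open>x\<close> in the ball the supremum may be tested on the ball around \<open>x\<close> of twice the radius.\<close>

lemma nn_integral_oscillation_le:
  fixes x :: "real ^ 'n"
  assumes "x \<in> cball 0 R" "0 < R"
  shows "(\<integral>\<^sup>+ y\<in>cball 0 R. (ennreal \<bar>b x - b y\<bar> * h y) \<partial>lebesgue) \<le>
    ennreal (2 ^ CARD('n)) * emeasure lebesgue (cball (0 :: real ^ 'n) R) * maximal_commutator_enn b h x"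
proof -
  define E where "E = emeasure lebesgue (cball x (2 * R))"
  have E: "E = ennreal (2 ^ CARD('n)) * emeasure lebesgue (cball (0 :: real ^ 'n) R)"
    unfolding E_def using \<open>0 < R\<close>
    by (subst (1 2) emeasure_lebesgue_cball) (auto simp: power_mult_distrib mult_ac simp flip: ennreal_mult)
  define v where "v = unit_ball_vol (CARD('n)) * (2 * R) ^ CARD('n)"
  have "0 < v"
    using \<open>0 < R\<close> by (simp add: v_def)
  moreover have "E = ennreal v"
    unfolding E_def v_def using \<open>0 < R\<close> by (intro emeasure_lebesgue_cball) auto
  ultimately have pos: "E \<noteq> 0" "E \<noteq> top"
    by auto
  have sub: "cball 0 R \<subseteq> cball x (2 * R)"
  proof
    fix y :: "real ^ 'n" assume "y \<in> cball 0 R"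
    then show "y \<in> cball x (2 * R)"
      using assms(1) norm_triangle_ineq4[of x y] by (auto simp: dist_norm)
  qed
  have "(\<integral>\<^sup>+ y\<in>cball 0 R. (ennreal \<bar>b x - b y\<bar> * h y) \<partial>lebesgue) \<le>
    (\<integral>\<^sup>+ y\<in>cball x (2 * R). (ennreal \<bar>b x - b y\<bar> * h y) \<partial>lebesgue)"
    using sub by (intro nn_integral_mono mult_left_mono) (auto simp: indicator_def)
  also have "\<dots> = E * ((\<integral>\<^sup>+ y\<in>cball x (2 * R). (ennreal \<bar>b x - b y\<bar> * h y) \<partial>lebesgue) / E)"
    unfolding ennreal_times_divide mult.commute[of E] by (rule mult_divide_eq_ennreal[OF pos, symmetric])
  also have "\<dots> \<le> E * maximal_commutator_enn b h x"
    unfolding maximal_commutator_enn_def E_def using \<open>0 < R\<close>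
    by (intro mult_left_mono SUP_upper) auto
  finally show ?thesis
    unfolding E .
qed

section \<open>Oscillation estimates from boundedness on the mixed Lebesgue space\<close>

text \<open>The two hypotheses on \<open>b\<close> in the form in which they are used: BMO enters
  through centred dyadic balls, with reference values \<open>m k\<close>, and boundedness on the
  mixed Lebesgue space through nonnegative functions, together with measurability of their
  images.\<close>

locale bounded_commutator = mixed_exponents q
  for q :: "real ^ 'n::{finite,linorder}" +
  fixes b :: "real ^ 'n::{finite,linorder} \<Rightarrow> real" and C :: real and m :: "int \<Rightarrow> real" and D :: real
  assumes measurable_b [measurable]: "b \<in> borel_measurable lebesgue"
    and C_pos: "0 < C"
    and measurable_M: "\<And>h. h \<in> borel_measurable lebesgue \<Longrightarrow> N h < \<infinity> \<Longrightarrow>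
      maximal_commutator_enn b h \<in> borel_measurable lebesgue"
    and N_M_le: "\<And>h. h \<in> borel_measurable lebesgue \<Longrightarrow> N h < \<infinity> \<Longrightarrow>
      N (maximal_commutator_enn b h) \<le> ennreal C * N h"
    and D_pos: "0 < D"
    and mean_oscillation: "\<And>k. (\<integral>\<^sup>+ y\<in>cball 0 (2 powr real_of_int k). ennreal \<bar>b y - m k\<bar> \<partial>lebesgue) \<le>
      ennreal D * emeasure lebesgue (cball (0 :: real ^ 'n::{finite,linorder}) (2 powr real_of_int k))"
begin

abbreviation M :: "(real ^ 'n::{finite,linorder} \<Rightarrow> ennreal) \<Rightarrow> real ^ 'n::{finite,linorder} \<Rightarrow> ennreal" where
  "M \<equiv> maximal_commutator_enn b"

definition B :: "int \<Rightarrow> (real ^ 'n::{finite,linorder}) set" where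
  "B k = cball 0 (2 powr real_of_int k)"

definition E :: "int \<Rightarrow> real" where
  "E k = unit_ball_vol (CARD('n)) * 2 powr (real_of_int k * CARD('n))"

lemma measurable_B [measurable, simp]: "B k \<in> sets lebesgue" "B k \<in> sets borel"
  by (simp_all add: B_def)

lemma E_pos: "0 < E k"
  by (simp add: E_def)

lemma emeasure_B: "emeasure lebesgue (B k) = ennreal (E k)"
  unfolding B_def E_def by (subst emeasure_lebesgue_cball) (auto simp: powr_powr simp flip: powr_realpow)

lemma E_Suc: "E (k + 1) = 2 ^ CARD('n) * E k"
  by (simp add: E_def powr_add distrib_right powr_realpow)

lemma mean_oscillation_B: "(\<integral>\<^sup>+ y\<in>B k. ennreal \<bar>b y - m k\<bar> \<partial>lebesgue) \<le> ennreal (D * E k)"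
  using mean_oscillation[of k] D_pos E_pos[of k] emeasure_B[of k]
  by (simp add: B_def ennreal_mult)

lemma B_mono: "j \<le> k \<Longrightarrow> B j \<subseteq> B k"
  unfolding B_def by (intro subset_cball) auto

text \<open>Both reference values are compared with \<open>b\<close> on the smaller ball
  \<open>B k\<close>; the oscillation around \<open>m (k + 1)\<close> is bounded on the larger ball,
  whose volume is 2^n times as large.\<close>

lemma average_step: "\<bar>m k - m (k + 1)\<bar> \<le> D * (1 + 2 ^ CARD('n))"
proof -
  have "ennreal (\<bar>m k - m (k + 1)\<bar> * E k) = (\<integral>\<^sup>+ y\<in>B k. ennreal \<bar>m k - m (k + 1)\<bar> \<partial>lebesgue)"
    using E_pos[of k] by (subst nn_integral_cmult_indicator) (auto simp: emeasure_B ennreal_mult)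
  also have "\<dots> \<le> (\<integral>\<^sup>+ y. ennreal \<bar>b y - m k\<bar> * indicator (B k) y +
      ennreal \<bar>b y - m (k + 1)\<bar> * indicator (B (k + 1)) y \<partial>lebesgue)"
    using B_mono[of k "k + 1"]
    by (intro nn_integral_mono) (auto simp: indicator_def simp flip: ennreal_plus intro!: ennreal_leI)
  also have "\<dots> = (\<integral>\<^sup>+ y\<in>B k. ennreal \<bar>b y - m k\<bar> \<partial>lebesgue) +
      (\<integral>\<^sup>+ y\<in>B (k + 1). ennreal \<bar>b y - m (k + 1)\<bar> \<partial>lebesgue)"
    by (intro nn_integral_add) measurable
  also have "\<dots> \<le> ennreal (D * E k) + ennreal (D * E (k + 1))"
    by (intro add_mono mean_oscillation_B)
  also have "\<dots> = ennreal (D * (1 + 2 ^ CARD('n)) * E k)"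
    unfolding E_Suc using D_pos E_pos[of k] by (simp add: algebra_simps flip: ennreal_plus)
  finally show ?thesis
    using E_pos[of k] D_pos by (subst (asm) ennreal_le_iff) (auto intro: mult_right_le_imp_le simp: add_pos_pos)
qed

lemma average_diff: "\<bar>m j - m k\<bar> \<le> D * (1 + 2 ^ CARD('n)) * \<bar>real_of_int j - real_of_int k\<bar>"
proof -
  have *: "\<bar>m j - m (j + int n)\<bar> \<le> D * (1 + 2 ^ CARD('n)) * real n" for j n
  proof (induction n)
    case (Suc n)
    have "j + int (Suc n) = j + int n + 1"
      by simp
    then have "\<bar>m j - m (j + int (Suc n))\<bar> \<le> \<bar>m j - m (j + int n)\<bar> + \<bar>m (j + int n) - m (j + int n + 1)\<bar>"
      by (simp only:)
    also have "\<dots> \<le> D * (1 + 2 ^ CARD('n)) * real n + D * (1 + 2 ^ CARD('n))"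
      by (intro add_mono Suc average_step)
    finally show ?case
      by (simp add: algebra_simps)
  qed simp
  show ?thesis
  proof (cases "j \<le> k")
    case True
    then have "\<bar>real_of_int j - real_of_int k\<bar> = real_of_int k - real_of_int j"
      by simp
    with True show ?thesis using *[of j "nat (k - j)"] by simp
  next
    case False
    then show ?thesis using *[of k "nat (j - k)"] by (simp add: abs_minus_commute)
  qed
qed

text \<open>Average |b x - m k| <= |b x - b y| + |b y - m k| over y in \<open>B k\<close>. The first
  average tests \<open>M (indicator (B k))\<close> on a ball around x of twice the radius, which
  costs the volume ratio 2^n.\<close>

lemma osc_pointwise_le:
  assumes "x \<in> B k"
  shows "ennreal \<bar>b x - m k\<bar> \<le> ennreal (2 ^ CARD('n)) * M (indicator (B k)) x + ennreal D"
proof -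
  have "ennreal (E k) * ennreal \<bar>b x - m k\<bar> = (\<integral>\<^sup>+ y\<in>B k. ennreal \<bar>b x - m k\<bar> \<partial>lebesgue)"
    by (subst nn_integral_cmult_indicator) (auto simp: emeasure_B mult.commute)
  also have "\<dots> \<le> (\<integral>\<^sup>+ y. (ennreal \<bar>b x - b y\<bar> * indicator (B k) y) * indicator (B k) y +
      ennreal \<bar>b y - m k\<bar> * indicator (B k) y \<partial>lebesgue)"
    by (intro nn_integral_mono) (auto simp: indicator_def simp flip: ennreal_plus intro!: ennreal_leI)
  also have "\<dots> = (\<integral>\<^sup>+ y\<in>B k. (ennreal \<bar>b x - b y\<bar> * indicator (B k) y) \<partial>lebesgue) +
      (\<integral>\<^sup>+ y\<in>B k. ennreal \<bar>b y - m k\<bar> \<partial>lebesgue)"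
    by (intro nn_integral_add) measurable
  also have "\<dots> \<le> ennreal (2 ^ CARD('n)) * ennreal (E k) * M (indicator (B k)) x + ennreal (D * E k)"
    using nn_integral_oscillation_le[of x "2 powr k" b "indicator (B k)"] assms
    by (intro add_mono mean_oscillation_B) (auto simp: B_def[symmetric] emeasure_B)
  also have "\<dots> = ennreal (E k) * (ennreal (2 ^ CARD('n)) * M (indicator (B k)) x + ennreal D)"
    using D_pos E_pos[of k] by (simp add: ennreal_mult distrib_left mult_ac)
  finally show ?thesis
    using E_pos[of k] by (subst (asm) ennreal_mult_le_mult_iff) auto
qed

text \<open>The part of the constant in \<open>nn_integral_le_N\<close> that does not depend on j
  when R = 2^j.\<close>

definition K0 :: real where
  "K0 = 2 ^ CARD('n) * 2 powr (CARD('n) - \<sigma>)"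

lemma nn_integral_B_le:
  assumes [measurable]: "h \<in> borel_measurable lebesgue"
  shows "(\<integral>\<^sup>+ y\<in>B j. h y \<partial>lebesgue) \<le> ennreal (K0 * 2 powr (real_of_int j * (CARD('n) - \<sigma>))) * N (\<lambda>y. h y * indicator (B j) y)"
proof -
  have "(\<integral>\<^sup>+ y\<in>B j. h y \<partial>lebesgue) \<le> ennreal (2 ^ CARD('n) * (2 * 2 powr j) powr (CARD('n) - \<sigma>)) *
      N (\<lambda>y. h y * indicator (B j) y)"
  proof (rule nn_integral_le_N)
    show "(\<lambda>y. h y * indicator (B j) y) \<in> borel_measurable lebesgue"
      by measurable
  qed (auto simp: B_def)
  also have "2 ^ CARD('n) * (2 * 2 powr j) powr (CARD('n) - \<sigma>) = K0 * 2 powr (real_of_int j * (CARD('n) - \<sigma>))"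
    by (simp add: K0_def powr_mult powr_powr)
  finally show ?thesis .
qed

text \<open>In effect a bound for \<open>b - m j\<close> in the dual norm on \<open>B j\<close>: the
  pairing with an arbitrary \<open>h\<close> costs the same power of 2^j as the pairing of the
  constant 1 with \<open>h\<close>.\<close>

lemma nn_integral_osc_le:
  assumes [measurable]: "h \<in> borel_measurable lebesgue" and fin: "N h < \<infinity>"
    and supp: "\<And>y. y \<notin> B j \<Longrightarrow> h y = 0"
  shows "(\<integral>\<^sup>+ y. ennreal \<bar>b y - m j\<bar> * h y \<partial>lebesgue) \<le>
    ennreal ((2 ^ CARD('n) * C + D) * K0 * 2 powr (real_of_int j * (CARD('n) - \<sigma>))) * N h"
proof -
  define L where "L = (\<integral>\<^sup>+ y. ennreal \<bar>b y - m j\<bar> * h y \<partial>lebesgue)"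
  define H where "H = (\<integral>\<^sup>+ y. h y \<partial>lebesgue)"
  define c where "c = K0 * 2 powr (real_of_int j * (CARD('n) - \<sigma>))"
  have c: "c > 0"
    by (simp add: c_def K0_def)
  have hB: "h y * indicator (B j) y = h y" for y
    using supp[of y] by (auto simp: indicator_def)
  have H: "H \<le> ennreal c * N h"
    using nn_integral_B_le[of h j] by (simp add: hB H_def c_def)
  have M_meas [measurable]: "M h \<in> borel_measurable lebesgue"
    by (intro measurable_M fin) measurable
  \<comment> \<open>The left side is free of x, so the bound can be integrated over x in
    \<open>B j\<close>; there boundedness controls \<open>M h\<close>, and mean oscillation controls
    the other term.\<close>
  have pw: "L \<le> ennreal (2 ^ CARD('n) * E j) * M h x + H * ennreal \<bar>b x - m j\<bar>" if "x \<in> B j" for x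
  proof -
    have "L \<le> (\<integral>\<^sup>+ y. ennreal \<bar>b x - b y\<bar> * h y + ennreal \<bar>b x - m j\<bar> * h y \<partial>lebesgue)"
      unfolding L_def distrib_right[symmetric]
      by (intro nn_integral_mono mult_right_mono) (auto simp flip: ennreal_plus intro!: ennreal_leI)
    also have "\<dots> = (\<integral>\<^sup>+ y\<in>B j. (ennreal \<bar>b x - b y\<bar> * h y) \<partial>lebesgue) + ennreal \<bar>b x - m j\<bar> * H"
      by (simp add: nn_integral_add nn_integral_cmult H_def hB mult.assoc)
    also have "\<dots> \<le> ennreal (2 ^ CARD('n)) * ennreal (E j) * M h x + ennreal \<bar>b x - m j\<bar> * H"
      using nn_integral_oscillation_le[of x "2 powr j" b h] that
      by (intro add_mono) (auto simp: B_def[symmetric] emeasure_B)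
    finally show ?thesis
      using E_pos[of j] by (simp add: ennreal_mult mult_ac)
  qed
  have "ennreal (E j) * L = (\<integral>\<^sup>+ x\<in>B j. L \<partial>lebesgue)"
    by (subst nn_integral_cmult_indicator) (auto simp: emeasure_B mult.commute)
  also have "\<dots> \<le> (\<integral>\<^sup>+ x. ennreal (2 ^ CARD('n) * E j) * (M h x * indicator (B j) x) +
      H * (ennreal \<bar>b x - m j\<bar> * indicator (B j) x) \<partial>lebesgue)"
    using pw by (intro nn_integral_mono) (auto simp: indicator_def)
  also have "\<dots> = ennreal (2 ^ CARD('n) * E j) * (\<integral>\<^sup>+ x\<in>B j. M h x \<partial>lebesgue) +
      H * (\<integral>\<^sup>+ x\<in>B j. ennreal \<bar>b x - m j\<bar> \<partial>lebesgue)"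
    by (simp add: nn_integral_add nn_integral_cmult)
  also have "\<dots> \<le> ennreal (2 ^ CARD('n) * E j) * (ennreal c * (ennreal C * N h)) +
      ennreal c * N h * ennreal (D * E j)"
  proof (intro add_mono mult_mono mult_left_mono mean_oscillation_B H)
    have "(\<integral>\<^sup>+ x\<in>B j. M h x \<partial>lebesgue) \<le> ennreal c * N (\<lambda>x. M h x * indicator (B j) x)"
      unfolding c_def by (rule nn_integral_B_le) measurable
    also have "\<dots> \<le> ennreal c * N (M h)"
      by (intro mult_left_mono N_mono) (auto simp: indicator_def)
    also have "\<dots> \<le> ennreal c * (ennreal C * N h)"
      by (intro mult_left_mono N_M_le fin) auto
    finally show "(\<integral>\<^sup>+ x\<in>B j. M h x \<partial>lebesgue) \<le> ennreal c * (ennreal C * N h)" .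
  qed auto
  also have "\<dots> = ennreal (E j) * (ennreal ((2 ^ CARD('n) * C + D) * c) * N h)"
    using E_pos[of j] c C_pos D_pos
    by (simp add: ennreal_mult distrib_left distrib_right mult_ac)
  finally have "L \<le> ennreal ((2 ^ CARD('n) * C + D) * c) * N h"
    using E_pos[of j] by (subst (asm) ennreal_mult_le_mult_iff) auto
  then show ?thesis
    by (simp add: L_def c_def mult.assoc)
qed

end

section \<open>Decomposition into dyadic annuli\<close>

lemma mem_dyadic_annulus_iff:
  fixes x :: "real ^ 'n"
  shows "x \<in> dyadic_annulus k \<longleftrightarrow> 2 powr real_of_int (k - 1) < norm x \<and> norm x \<le> 2 powr real_of_int k"
  by (auto simp: dyadic_annulus_def)

lemma dyadic_annulus_measurable [measurable, simp]:
  "(dyadic_annulus k :: (real ^ 'n) set) \<in> sets borel"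
  "(dyadic_annulus k :: (real ^ 'n) set) \<in> sets lebesgue"
proof -
  show "(dyadic_annulus k :: (real ^ 'n) set) \<in> sets borel"
    unfolding dyadic_annulus_def by (intro sets.Diff borel_closed) auto
  then show "(dyadic_annulus k :: (real ^ 'n) set) \<in> sets lebesgue"
    by simp
qed

lemma ex_dyadic_annulus:
  fixes x :: "real ^ 'n"
  assumes "x \<noteq> 0"
  shows "x \<in> dyadic_annulus \<lceil>log 2 (norm x)\<rceil>"
proof -
  define l where "l = log 2 (norm x)"
  have "norm x = 2 powr l"
    using assms by (simp add: l_def)
  moreover have "real_of_int (\<lceil>l\<rceil> - 1) < l" "l \<le> real_of_int \<lceil>l\<rceil>"
    by linarith+
  ultimately show ?thesis
    unfolding mem_dyadic_annulus_iff l_def[symmetric]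
    by (metis one_less_numeral_iff powr_less_cancel_iff powr_le_cancel_iff semiring_norm(76))
qed

text \<open>With l the larger index, the outer point has norm above 2^(l-1) and the inner one at
  most 2^(l-2), since the indices differ by at least 2.\<close>

lemma dyadic_annulus_far:
  fixes x y :: "real ^ 'n"
  assumes "x \<in> dyadic_annulus k" "y \<in> dyadic_annulus j" "2 \<le> \<bar>j - k\<bar>"
  shows "2 powr real_of_int (max j k - 2) \<le> dist x y"
proof -
  have *: "2 powr real_of_int (l - 2) \<le> norm u - norm v"
    if "u \<in> dyadic_annulus l" "v \<in> dyadic_annulus i" "i + 2 \<le> l" for u v :: "real ^ 'n" and l i
  proof -
    have "2 powr real_of_int (l - 1) = 2 * 2 powr real_of_int (l - 2)"
      by (simp add: powr_diff)
    moreover have "2 powr real_of_int i \<le> 2 powr real_of_int (l - 2)"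
      using that(3) by (intro powr_mono) auto
    ultimately show ?thesis
      using that(1,2) unfolding mem_dyadic_annulus_iff by linarith
  qed
  show ?thesis
  proof (cases "j \<le> k")
    case True
    then show ?thesis
      using *[of x k y j] assms norm_triangle_ineq2[of x y] by (simp add: dist_norm)
  next
    case False
    then show ?thesis
      using *[of y j x k] assms norm_triangle_ineq2[of y x] by (simp add: dist_norm norm_minus_commute)
  qed
qed

section \<open>The kernel that links two annuli\<close>

context mixed_exponents
begin

text \<open>The power of 2 combines the Hoelder constant 2^(j (n - \<sigma>)) on \<open>B j\<close>
  with the reciprocal volume 2^(-max(j,k) n), up to a constant, of the smallest relevant ball around
  a point of A_k. The linear factor accounts for the drift from \<open>m k\<close> to
  \<open>m j\<close>.\<close>

definition weight :: "int \<Rightarrow> int \<Rightarrow> real" where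
  "weight k j = 2 powr (real_of_int j * (CARD('n) - \<sigma>) - real_of_int (max j k) * CARD('n)) *
    (1 + \<bar>real_of_int j - real_of_int k\<bar>)"

lemma weight_pos: "0 < weight k j"
  by (simp add: weight_def add_pos_nonneg)

lemma \<sigma>_bounds: "0 \<le> \<sigma>" "\<sigma> \<le> CARD('n)"
proof -
  show "0 \<le> \<sigma>"
    unfolding \<sigma>_def by (intro sum_nonneg) (simp add: exponent_pos less_imp_le)
  have "\<sigma> \<le> (\<Sum>i\<in>(UNIV :: 'n set). 1)"
    unfolding \<sigma>_def by (intro sum_mono) (simp add: exponent_pos less_imp_le exponent_gt_1)
  then show "\<sigma> \<le> CARD('n)"
    by simp
qed

end

context bounded_commutator
begin

text \<open>The middle factor collects the constants of the three oscillation terms in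
  \<open>far_annulus_le\<close>. The factor 4^n over \<open>unit_ball_vol\<close> stems from the
  radius 2^(max(j,k) - 2), whose exponent falls short of that in \<open>weight\<close> by 2.\<close>

definition K1 :: real where
  "K1 = K0 * (2 ^ CARD('n) + 2 * D + D * (1 + 2 ^ CARD('n)) + 2 ^ CARD('n) * C) * 4 ^ CARD('n) /
    unit_ball_vol (CARD('n))"

text \<open>The oscillation is split into |b x - m k|, |m j - m k| and |b y - m j|, one estimate for
  each. The bound is free of r and depends on x only through a factor that is the same for all j,
  which permits summation over j at a fixed point.\<close>

lemma far_annulus_le:
  fixes h :: "real ^ 'n::{finite,linorder} \<Rightarrow> ennreal"
  assumes [measurable]: "h \<in> borel_measurable lebesgue" and fin: "N h < \<infinity>"
    and supp: "\<And>y. y \<notin> dyadic_annulus j \<Longrightarrow> h y = 0"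
    and x: "x \<in> dyadic_annulus k" and far: "2 \<le> \<bar>j - k\<bar>" and "0 < r"
  shows "(\<integral>\<^sup>+ y\<in>cball x r. (ennreal \<bar>b x - b y\<bar> * h y) \<partial>lebesgue) / emeasure lebesgue (cball x r) \<le>
    ennreal (K1 * weight k j) * N h * (M (indicator (B k)) x + 1)"
proof (cases "cball x r \<inter> dyadic_annulus j = {}")
  case True
  then have "(ennreal \<bar>b x - b y\<bar> * h y) * indicator (cball x r) y = 0" for y
    using supp[of y] True by (auto simp: indicator_def disjoint_iff)
  then have "(\<integral>\<^sup>+ y\<in>cball x r. (ennreal \<bar>b x - b y\<bar> * h y) \<partial>lebesgue) = (\<integral>\<^sup>+ y. 0 \<partial>(lebesgue :: (real ^ 'n::{finite,linorder}) measure))"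
    by (intro nn_integral_cong)
  then show ?thesis
    by simp
next
  case False
  then obtain y where "dist x y \<le> r" "y \<in> dyadic_annulus j"
    by auto
  with dyadic_annulus_far[OF x _ far, of y] have r: "2 powr real_of_int (max j k - 2) \<le> r"
    by linarith
  define e where "e = E (max j k - 2)"
  have e: "0 < e"
    by (simp add: e_def E_pos)
  have "ennreal e = emeasure lebesgue (cball x (2 powr real_of_int (max j k - 2)))"
    unfolding e_def E_def by (subst emeasure_lebesgue_cball) (auto simp: powr_powr simp flip: powr_realpow)
  also have "\<dots> \<le> emeasure lebesgue (cball x r)"
    using r by (intro emeasure_mono) auto
  finally have vol: "ennreal e \<le> emeasure lebesgue (cball x r)" .
  have xB: "x \<in> B k"
    using x by (simp add: B_def mem_dyadic_annulus_iff)
  have hB: "h y * indicator (B j) y = h y" for y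
    using supp[of y] by (auto simp: indicator_def B_def mem_dyadic_annulus_iff)
  define c where "c = K0 * 2 powr (real_of_int j * (CARD('n) - \<sigma>))"
  have c: "0 < c"
    by (simp add: c_def K0_def)
  define P where "P = M (indicator (B k)) x"
  define t where "t = \<bar>real_of_int j - real_of_int k\<bar>"
  define D' where "D' = D * (1 + 2 ^ CARD('n))"
  have D': "0 < D'"
    using D_pos by (simp add: D'_def add_pos_pos)
  \<comment> \<open>Chosen so that \<open>K' * (1 + t) * (u + 1)\<close> minus the sum of the three
    bounds, with u the value of \<open>P\<close>, expands into nonnegative terms; \<open>D\<close>
    appears twice because the terms at x and at y each contribute it.\<close>
  define K' where "K' = 2 ^ CARD('n) + 2 * D + D' + 2 ^ CARD('n) * C"
  have K': "0 < K'"
    using D' D_pos C_pos by (simp add: K'_def add_pos_pos)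
  have "(\<integral>\<^sup>+ y\<in>cball x r. (ennreal \<bar>b x - b y\<bar> * h y) \<partial>lebesgue) \<le>
    (\<integral>\<^sup>+ y. (ennreal \<bar>b x - m k\<bar> + ennreal \<bar>m j - m k\<bar>) * h y + ennreal \<bar>b y - m j\<bar> * h y \<partial>lebesgue)"
    unfolding distrib_right[symmetric]
  proof (intro nn_integral_mono)
    fix y
    have "(ennreal \<bar>b x - b y\<bar> * h y) * indicator (cball x r) y \<le> ennreal \<bar>b x - b y\<bar> * h y"
      by (auto simp: indicator_def)
    also have "\<dots> \<le> (ennreal \<bar>b x - m k\<bar> + ennreal \<bar>m j - m k\<bar> + ennreal \<bar>b y - m j\<bar>) * h y"
      by (intro mult_right_mono) (auto simp flip: ennreal_plus intro!: ennreal_leI)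
    finally show "(ennreal \<bar>b x - b y\<bar> * h y) * indicator (cball x r) y \<le> \<dots>" .
  qed
  also have "\<dots> = (ennreal \<bar>b x - m k\<bar> + ennreal \<bar>m j - m k\<bar>) * (\<integral>\<^sup>+ y. h y \<partial>lebesgue) +
      (\<integral>\<^sup>+ y. ennreal \<bar>b y - m j\<bar> * h y \<partial>lebesgue)"
    by (simp add: nn_integral_add nn_integral_cmult)
  also have "\<dots> \<le> (ennreal (2 ^ CARD('n)) * P + ennreal D + ennreal (D' * t)) * (ennreal c * N h) +
      ennreal ((2 ^ CARD('n) * C + D) * c) * N h"
  proof (intro add_mono mult_mono)
    show "ennreal \<bar>b x - m k\<bar> \<le> ennreal (2 ^ CARD('n)) * P + ennreal D"
      unfolding P_def by (rule osc_pointwise_le[OF xB])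
    show "ennreal \<bar>m j - m k\<bar> \<le> ennreal (D' * t)"
      unfolding D'_def t_def by (intro ennreal_leI average_diff)
    show "(\<integral>\<^sup>+ y. h y \<partial>lebesgue) \<le> ennreal c * N h"
      using nn_integral_B_le[of h j] by (simp add: hB c_def)
    show "(\<integral>\<^sup>+ y. ennreal \<bar>b y - m j\<bar> * h y \<partial>lebesgue) \<le> ennreal ((2 ^ CARD('n) * C + D) * c) * N h"
      unfolding c_def mult.assoc[symmetric]
      by (rule nn_integral_osc_le[OF _ fin]) (use supp in \<open>auto simp: B_def mem_dyadic_annulus_iff\<close>)
  qed auto
  also have "\<dots> = (ennreal (2 ^ CARD('n)) * P + ennreal D + ennreal (D' * t) + ennreal (2 ^ CARD('n) * C + D)) *
      (ennreal c * N h)"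
    using c C_pos D_pos by (simp add: ennreal_mult distrib_right mult.assoc)
  also have "\<dots> \<le> (ennreal (K' * (1 + t)) * (P + 1)) * (ennreal c * N h)"
  proof (intro mult_right_mono)
    show "ennreal (2 ^ CARD('n)) * P + ennreal D + ennreal (D' * t) + ennreal (2 ^ CARD('n) * C + D) \<le>
      ennreal (K' * (1 + t)) * (P + 1)"
    proof (cases P)
      case (real u)
      have t: "0 \<le> t"
        by (simp add: t_def)
      define s where "s = (2::real) ^ CARD('n)"
      have s: "0 < s"
        by (simp add: s_def)
      have "s * u + D + D' * t + (s * C + D) \<le> K' * (1 + t) * (u + 1)"
      proof -
        have "K' * (1 + t) * (u + 1) - (s * u + D + D' * t + (s * C + D)) =
          s + (2 * D + D' + s * C) * u + D' + (2 * D + s * C + s) * t + K' * (t * u)"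
          by (simp add: K'_def s_def algebra_simps)
        also have "\<dots> \<ge> 0"
          using s D_pos D' C_pos t real(1) K' by (intro add_nonneg_nonneg mult_nonneg_nonneg) auto
        finally show ?thesis by simp
      qed
      then show ?thesis
        using real t D' D_pos C_pos K' unfolding s_def[symmetric]
        by (simp add: s flip: ennreal_mult ennreal_plus ennreal_1)
           (simp add: ennreal_leI s less_imp_le flip: ennreal_mult ennreal_plus)
    next
      case top
      then show ?thesis
        using K' t_def by (simp add: ennreal_mult_top add_pos_nonneg)
    qed
  qed simp
  also have "\<dots> = ennreal (K' * (1 + t) * c) * N h * (P + 1)"
    using K' c by (simp add: ennreal_mult t_def mult_ac)
  also have "K' * (1 + t) * c = e * (K1 * weight k j)"
  proof -
    have "unit_ball_vol (real CARD('n)) \<noteq> 0"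
      by (metis less_irrefl of_nat_0_le_iff unit_ball_vol_pos)
    then have "e * (K1 * weight k j) = K' * (1 + t) * K0 * 4 ^ CARD('n) *
      (2 powr (real_of_int (max j k - 2) * CARD('n)) *
       2 powr (real_of_int j * (CARD('n) - \<sigma>) - real_of_int (max j k) * CARD('n)))"
      by (simp add: e_def E_def K1_def K'_def D'_def weight_def t_def)
    also have "2 powr (real_of_int (max j k - 2) * CARD('n)) *
       2 powr (real_of_int j * (CARD('n) - \<sigma>) - real_of_int (max j k) * CARD('n)) =
       2 powr (real_of_int j * (CARD('n) - \<sigma>) - 2 * CARD('n))"
      unfolding powr_add[symmetric] by (rule arg_cong[where f = "\<lambda>u. 2 powr u"]) (simp add: algebra_simps)
    also have "\<dots> = 2 powr (real_of_int j * (CARD('n) - \<sigma>)) / 4 ^ CARD('n)"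
    proof -
      have "2 powr (2 * real CARD('n)) = (4 :: real) ^ CARD('n)"
        using powr_powr[of 2 2 "real CARD('n)"] by (simp add: powr_realpow)
      then show ?thesis
        by (simp add: powr_diff)
    qed
    finally show ?thesis
      by (simp add: c_def)
  qed
  also have "ennreal (e * (K1 * weight k j)) * N h * (P + 1) = ennreal e * (ennreal (K1 * weight k j) * N h * (P + 1))"
    using e by (simp add: ennreal_mult' mult.assoc)
  finally have num: "(\<integral>\<^sup>+ y\<in>cball x r. (ennreal \<bar>b x - b y\<bar> * h y) \<partial>lebesgue) \<le> \<dots>" .
  show ?thesis
  proof (rule divide_le_posI_ennreal)
    show "0 < emeasure lebesgue (cball x r)"
      using vol e by (meson ennreal_less_zero_iff less_le_trans)
    show "(\<integral>\<^sup>+ y\<in>cball x r. (ennreal \<bar>b x - b y\<bar> * h y) \<partial>lebesgue) \<le>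
       emeasure lebesgue (cball x r) * (ennreal (K1 * weight k j) * N h * (M (indicator (B k)) x + 1))"
      using order_trans[OF num[unfolded P_def] mult_right_mono[OF vol]] by simp
  qed
qed

end

section \<open>The commutator on one annulus\<close>

lemma borel_measurable_nn_integral_count_space [measurable]:
  fixes f :: "'i \<Rightarrow> 'a \<Rightarrow> ennreal"
  assumes "countable I" and f [measurable]: "\<And>i. i \<in> I \<Longrightarrow> f i \<in> borel_measurable M"
  shows "(\<lambda>x. \<integral>\<^sup>+ i. f i x \<partial>count_space I) \<in> borel_measurable M"
proof -
  interpret sigma_finite_measure "count_space I"
    by (rule sigma_finite_measure_count_space_countable) fact
  have "(\<lambda>p. f (snd p) (fst p)) \<in> borel_measurable (M \<Otimes>\<^sub>M count_space I)"
    by (rule measurable_compose_countable'[where f = "\<lambda>i p. f i (fst p)" and g = snd and I = I])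
       (use assms in auto)
  then show ?thesis
    by (intro borel_measurable_nn_integral) (simp add: split_def)
qed

context bounded_commutator
begin

lemma K1_pos: "0 < K1"
  unfolding K1_def using C_pos D_pos
  by (intro divide_pos_pos mult_pos_pos add_pos_pos) (auto simp: K0_def)

text \<open>The annulus of x and its two neighbours stay inside \<open>M\<close>, since balls of
  arbitrarily small radius may meet them; every other annulus falls under
  \<open>far_annulus_le\<close>. The factor \<open>?W\<close> is a number, so the right side
  involves only two images under \<open>M\<close>.\<close>

lemma M_pointwise_le:
  fixes h :: "real ^ 'n::{finite,linorder} \<Rightarrow> ennreal" and k :: int
  defines "A \<equiv> \<lambda>j y. h y * indicator (dyadic_annulus j) y"
  assumes [measurable]: "h \<in> borel_measurable lebesgue" and fin: "\<And>j. N (A j) < \<infinity>"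
    and x: "x \<in> dyadic_annulus k"
  shows "M h x \<le> M (\<lambda>y. A (k - 1) y + (A k y + A (k + 1) y)) x +
    ennreal K1 * (\<integral>\<^sup>+ j. ennreal (weight k j) * N (A j) \<partial>count_space UNIV) * (M (indicator (B k)) x + 1)"
    (is "_ \<le> M ?near x + _ * ?W * ?P")
proof -
  define J where "J = {j. 2 \<le> \<bar>j - k\<bar>}"
  have A_meas [measurable]: "A j \<in> borel_measurable lebesgue" for j
    unfolding A_def by measurable
  show ?thesis
    unfolding maximal_commutator_enn_def[of b h x]
  proof (rule SUP_least)
    fix r :: real assume "r \<in> {0<..}"
    then have r: "0 < r" by simp
    have [measurable]: "cball x r \<in> sets lebesgue"
      by simp
    define e where "e = emeasure lebesgue (cball x r)"
    define I where "I g = (\<integral>\<^sup>+ y\<in>cball x r. (ennreal \<bar>b x - b y\<bar> * g y) \<partial>lebesgue)"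
      for g :: "real ^ 'n::{finite,linorder} \<Rightarrow> ennreal"
    have "I h \<le> (\<integral>\<^sup>+ y. ennreal \<bar>b x - b y\<bar> * ?near y * indicator (cball x r) y +
      (\<integral>\<^sup>+ j. ennreal \<bar>b x - b y\<bar> * A j y * indicator (cball x r) y \<partial>count_space J) \<partial>lebesgue)"
      unfolding I_def
    proof (rule nn_integral_mono_AE)
      \<comment> \<open>The origin lies in no annulus, so the decomposition of \<open>h\<close>
        holds only off this null set.\<close>
      have "AE y in lebesgue. y \<noteq> (0 :: real ^ 'n::{finite,linorder})"
        by (intro AE_completion AE_lborel_singleton)
      then show "AE y in lebesgue. ennreal \<bar>b x - b y\<bar> * h y * indicator (cball x r) y
        \<le> ennreal \<bar>b x - b y\<bar> * ?near y * indicator (cball x r) y +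
          (\<integral>\<^sup>+ j. ennreal \<bar>b x - b y\<bar> * A j y * indicator (cball x r) y \<partial>count_space J)"
      proof eventually_elim
        case (elim y)
        then obtain j where j: "y \<in> dyadic_annulus j"
          using ex_dyadic_annulus by blast
        show ?case
        proof (cases "j \<in> J")
          case True
          have "ennreal \<bar>b x - b y\<bar> * h y * indicator (cball x r) y =
            ennreal \<bar>b x - b y\<bar> * A j y * indicator (cball x r) y"
            using j by (simp add: A_def)
          also have "\<dots> \<le> (\<integral>\<^sup>+ j. ennreal \<bar>b x - b y\<bar> * A j y * indicator (cball x r) y \<partial>count_space J)"
            by (rule nn_integral_ge_point[OF True])
          finally show ?thesis
            by (rule add_increasing[OF zero_le])
        next
          case False
          then have "j = k - 1 \<or> j = k \<or> j = k + 1"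
            by (auto simp: J_def)
          moreover have "A j y = h y"
            using j by (simp add: A_def)
          ultimately have "h y \<le> ?near y"
            by (auto simp: add_increasing add_increasing2)
          then have "ennreal \<bar>b x - b y\<bar> * h y * indicator (cball x r) y \<le>
            ennreal \<bar>b x - b y\<bar> * ?near y * indicator (cball x r) y"
            by (intro mult_right_mono mult_left_mono) auto
          then show ?thesis
            by (rule add_increasing2[OF zero_le])
        qed
      qed
    qed
    also have "\<dots> = I ?near + (\<integral>\<^sup>+ j. I (A j) \<partial>count_space J)"
    proof -
      have "(\<integral>\<^sup>+ j. I (A j) \<partial>count_space J) =
        (\<integral>\<^sup>+ y. \<integral>\<^sup>+ j. ennreal \<bar>b x - b y\<bar> * A j y * indicator (cball x r) y \<partial>count_space J \<partial>lebesgue)"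
        unfolding I_def by (rule nn_integral_count_space_nn_integral[symmetric], simp, measurable)
      then show ?thesis
        unfolding I_def by (simp add: nn_integral_add)
    qed
    finally have "I h / e \<le> (I ?near + (\<integral>\<^sup>+ j. I (A j) \<partial>count_space J)) / e"
      by (rule divide_right_mono_ennreal)
    also have "\<dots> = I ?near / e + (\<integral>\<^sup>+ j. I (A j) / e \<partial>count_space J)"
      by (simp add: divide_ennreal_def distrib_right nn_integral_multc)
    also have "\<dots> \<le> M ?near x + (\<integral>\<^sup>+ j. ennreal K1 * (ennreal (weight k j) * N (A j)) * ?P \<partial>count_space J)"
    proof (intro add_mono nn_integral_mono)
      show "I ?near / e \<le> M ?near x"
        unfolding maximal_commutator_enn_def I_def e_def using r by (intro SUP_upper) auto
      fix j assume "j \<in> space (count_space J)"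
      then have "I (A j) / e \<le> ennreal (K1 * weight k j) * N (A j) * ?P"
        unfolding I_def e_def
        by (intro far_annulus_le fin x r) (auto simp: J_def A_def)
      then show "I (A j) / e \<le> ennreal K1 * (ennreal (weight k j) * N (A j)) * ?P"
        using K1_pos weight_pos[of k j] by (simp add: ennreal_mult mult.assoc)
    qed
    also have "(\<integral>\<^sup>+ j. ennreal K1 * (ennreal (weight k j) * N (A j)) * ?P \<partial>count_space J) \<le>
      (\<integral>\<^sup>+ j. ennreal K1 * (ennreal (weight k j) * N (A j)) * ?P \<partial>count_space UNIV)"
      by (subst nn_integral_count_space_indicator, simp, intro nn_integral_mono) (auto simp: indicator_def)
    also have "\<dots> = ennreal K1 * ?W * ?P"
      by (simp add: nn_integral_multc nn_integral_cmult)
    finally show "I h / e \<le> M ?near x + ennreal K1 * ?W * ?P"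
      by simp
  qed
qed

text \<open>By the pointwise bound only \<open>M near\<close>, \<open>M ch\<close> and
  \<open>ch\<close> have to be normed, so finitely many uses of the quasi-triangle inequality
  suffice. The factor 2^(k \<sigma>) is the size of the norm of the indicator of
  \<open>B k\<close>.\<close>

lemma N_M_annulus_le:
  obtains K where "0 \<le> K"
    "\<And>h k. h \<in> borel_measurable lebesgue \<Longrightarrow>
      (\<And>j. N (\<lambda>y. h y * indicator (dyadic_annulus j) y) < \<infinity>) \<Longrightarrow>
      M h \<in> borel_measurable lebesgue \<Longrightarrow>
      N (\<lambda>x. M h x * indicator (dyadic_annulus k) x) \<le> ennreal K *
        (\<integral>\<^sup>+ j. ennreal (2 powr (real_of_int k * \<sigma>) * weight k j) *
          N (\<lambda>y. h y * indicator (dyadic_annulus j) y) \<partial>count_space UNIV)"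
proof -
  obtain Q where Q: "0 \<le> Q"
    "\<And>g h. g \<in> borel_measurable lebesgue \<Longrightarrow> h \<in> borel_measurable lebesgue \<Longrightarrow>
      N (\<lambda>x. g x + h x) \<le> ennreal Q * (N g + N h)"
    using N_add_le by blast
  define S where "S = 2 powr \<sigma>"
  define T where "T = (2::real) ^ CARD('n)"
  \<comment> \<open>Each \<open>Q\<close> is one use of the quasi-triangle inequality;
    \<open>T\<close> bounds a neighbouring annulus, \<open>C\<close> comes from boundedness of
    \<open>M\<close>, and \<open>S\<close> from the norm of the indicator of \<open>B k\<close>, at
    most S 2^(k \<sigma>).\<close>
  define K where "K = Q * (C * (Q * (T + Q * (T + T))) + Q * (K1 * (C * S) + K1 * S))"
  have pos: "0 < S" "0 < T"
    by (simp_all add: S_def T_def)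
  have "N (\<lambda>x. M h x * indicator (dyadic_annulus k) x) \<le> ennreal K *
        (\<integral>\<^sup>+ j. ennreal (2 powr (real_of_int k * \<sigma>) * weight k j) *
          N (\<lambda>y. h y * indicator (dyadic_annulus j) y) \<partial>count_space UNIV)"
    if h [measurable]: "h \<in> borel_measurable lebesgue"
      and fin: "\<And>j. N (\<lambda>y. h y * indicator (dyadic_annulus j) y) < \<infinity>"
      and Mh [measurable]: "M h \<in> borel_measurable lebesgue"
    for h :: "real ^ 'n::{finite,linorder} \<Rightarrow> ennreal" and k
  proof -
    define A where "A = (\<lambda>j y. h y * indicator (dyadic_annulus j) y)"
    have A [measurable]: "A j \<in> borel_measurable lebesgue" for j
      unfolding A_def by measurable
    have finA: "N (A j) < \<infinity>" for j
      unfolding A_def by (rule fin)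
    define near where "near = (\<lambda>y. A (k - 1) y + (A k y + A (k + 1) y))"
    have near [measurable]: "near \<in> borel_measurable lebesgue"
      unfolding near_def by measurable
    define ch :: "real ^ 'n::{finite,linorder} \<Rightarrow> ennreal" where "ch = indicator (B k)"
    have ch [measurable]: "ch \<in> borel_measurable lebesgue"
      unfolding ch_def by measurable
    define W where "W = (\<integral>\<^sup>+ j. ennreal (weight k j) * N (A j) \<partial>count_space UNIV)"
    define w where "w = 2 powr (real_of_int k * \<sigma>)"
    have w: "0 < w" by (simp add: w_def)
    define G where "G = ennreal w * W"
    have G: "G = (\<integral>\<^sup>+ j. ennreal (w * weight k j) * N (A j) \<partial>count_space UNIV)"
      using w weight_pos[of k] by (simp add: G_def W_def ennreal_mult' mult.assoc nn_integral_cmult)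
    have Nch: "N ch \<le> ennreal (S * w)"
      using N_indicator_cball_le[of "2 powr real_of_int k"]
      by (simp add: ch_def B_def powr_mult powr_powr S_def w_def)
    then have finch: "N ch < \<infinity>"
      by (simp add: le_less_trans)
    have Mch [measurable]: "M ch \<in> borel_measurable lebesgue"
      by (intro measurable_M ch finch)
    have NMch: "N (M ch) \<le> ennreal (C * (S * w))"
    proof -
      have "N (M ch) \<le> ennreal C * N ch"
        by (intro N_M_le ch finch)
      also have "\<dots> \<le> ennreal C * ennreal (S * w)"
        by (intro mult_left_mono Nch) auto
      finally show ?thesis
        using C_pos by (simp add: ennreal_mult')
    qed
    \<comment> \<open>For the three near annuli the exponent in \<open>w * weight k j\<close> is -(n
      - \<sigma>), 0 or -\<sigma>, hence at least -n. With T = 2^n they are therefore absorbed into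
      the same sum \<open>G\<close> as the distant ones.\<close>
    have single: "N (A j) \<le> ennreal T * G" if j: "j = k - 1 \<or> j = k \<or> j = k + 1" for j
    proof -
      define ex where "ex = real_of_int k * \<sigma> + (real_of_int j * (CARD('n) - \<sigma>) - real_of_int (max j k) * CARD('n))"
      have "- real CARD('n) \<le> ex"
        using j \<sigma>_bounds by (auto simp: ex_def algebra_simps)
      then have "2 powr (- real CARD('n)) \<le> 2 powr ex"
        by simp
      then have "1 \<le> T * 2 powr ex"
        by (simp add: T_def powr_minus powr_realpow field_simps)
      also have "\<dots> \<le> T * 2 powr ex * (1 + \<bar>real_of_int j - real_of_int k\<bar>)"
        using mult_left_mono[of 1 "1 + \<bar>real_of_int j - real_of_int k\<bar>" "T * 2 powr ex"] pos by simp
      also have "\<dots> = T * (w * weight k j)"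
        by (simp add: w_def weight_def ex_def powr_add)
      finally have "1 \<le> ennreal (T * (w * weight k j))"
        by simp
      then have "1 * N (A j) \<le> ennreal (T * (w * weight k j)) * N (A j)"
        by (rule mult_right_mono) simp
      also have "\<dots> = ennreal T * (ennreal (w * weight k j) * N (A j))"
        using pos by (simp add: ennreal_mult' mult.assoc)
      also have "\<dots> \<le> ennreal T * G"
        unfolding G by (intro mult_left_mono nn_integral_ge_point[where A = UNIV]) auto
      finally show ?thesis by simp
    qed
    have near_fin: "N near < \<infinity>"
    proof -
      have "N (\<lambda>y. A k y + A (k + 1) y) \<le> ennreal Q * (N (A k) + N (A (k + 1)))"
        by (rule Q(2)) measurable
      also have "\<dots> < \<infinity>"
        using finA by (simp add: ennreal_mult_less_top)
      finally have *: "N (\<lambda>y. A k y + A (k + 1) y) < \<infinity>" .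
      have "N near \<le> ennreal Q * (N (A (k - 1)) + N (\<lambda>y. A k y + A (k + 1) y))"
        unfolding near_def by (rule Q(2)) measurable
      also have "\<dots> < \<infinity>"
        using finA * by (simp add: ennreal_mult_less_top)
      finally show ?thesis .
    qed
    have near_le: "N near \<le> ennreal (Q * (T + Q * (T + T))) * G"
    proof -
      have "N near \<le> ennreal Q * (N (A (k - 1)) + N (\<lambda>y. A k y + A (k + 1) y))"
        unfolding near_def by (rule Q(2)) measurable
      also have "\<dots> \<le> ennreal Q * (N (A (k - 1)) + ennreal Q * (N (A k) + N (A (k + 1))))"
        by (intro mult_left_mono add_left_mono Q(2)) measurable
      also have "\<dots> \<le> ennreal Q * (ennreal T * G + ennreal Q * (ennreal T * G + ennreal T * G))"
        by (intro mult_left_mono add_mono single) auto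
      also have "\<dots> = ennreal (Q * (T + Q * (T + T))) * G"
      proof -
        have "ennreal (Q * (T + Q * (T + T))) = ennreal Q * (ennreal T + ennreal Q * (ennreal T + ennreal T))"
          using Q(1) pos by (simp only: ennreal_mult ennreal_plus less_imp_le add_nonneg_nonneg mult_nonneg_nonneg)
        then show ?thesis
          by (simp only: distrib_left distrib_right mult_ac)
      qed
      finally show ?thesis .
    qed
    have M_near [measurable]: "M near \<in> borel_measurable lebesgue"
      by (intro measurable_M near near_fin)
    have "N (\<lambda>x. M h x * indicator (dyadic_annulus k) x) \<le>
      N (\<lambda>x. M near x + (ennreal K1 * W * M ch x + ennreal K1 * W * ch x))"
    proof (rule N_mono)
      fix x
      show "M h x * indicator (dyadic_annulus k) x \<le>
        M near x + (ennreal K1 * W * M ch x + ennreal K1 * W * ch x)"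
      proof (cases "x \<in> dyadic_annulus k")
        case True
        then have "ch x = 1"
          by (simp add: ch_def B_def mem_dyadic_annulus_iff)
        then show ?thesis
          using M_pointwise_le[OF h fin True] True
          by (simp add: A_def near_def W_def ch_def distrib_left)
      qed simp
    qed
    also have "\<dots> \<le> ennreal Q * (N (M near) + N (\<lambda>x. ennreal K1 * W * M ch x + ennreal K1 * W * ch x))"
      by (rule Q(2)) measurable
    also have "\<dots> \<le> ennreal Q * (N (M near) + ennreal Q * (N (\<lambda>x. ennreal K1 * W * M ch x) +
        N (\<lambda>x. ennreal K1 * W * ch x)))"
      by (intro mult_left_mono add_left_mono Q(2)) measurable
    also have "\<dots> = ennreal Q * (N (M near) + ennreal Q * (ennreal K1 * W * N (M ch) + ennreal K1 * W * N ch))"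
      by (simp add: N_cmult)
    also have "\<dots> \<le> ennreal Q * (ennreal C * (ennreal (Q * (T + Q * (T + T))) * G) +
        ennreal Q * (ennreal K1 * W * ennreal (C * (S * w)) + ennreal K1 * W * ennreal (S * w)))"
      by (intro mult_left_mono add_mono NMch Nch order_trans[OF N_M_le[OF near near_fin]] near_le) auto
    also have "\<dots> = ennreal K * G"
    proof -
      have "ennreal K = ennreal Q * (ennreal C * ennreal (Q * (T + Q * (T + T))) +
          ennreal Q * (ennreal K1 * (ennreal C * ennreal S) + ennreal K1 * ennreal S))"
        unfolding K_def using Q(1) pos K1_pos C_pos
        by (simp only: ennreal_mult ennreal_plus less_imp_le add_nonneg_nonneg mult_nonneg_nonneg)
      moreover have "ennreal (C * (S * w)) = ennreal C * (ennreal S * ennreal w)"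
        "ennreal (S * w) = ennreal S * ennreal w"
        using pos C_pos w by (simp_all add: ennreal_mult)
      ultimately show ?thesis
        by (simp only: G_def distrib_left distrib_right mult_ac)
    qed
    finally show ?thesis
      unfolding G w_def A_def .
  qed
  moreover have "0 \<le> K"
    using Q(1) pos K1_pos C_pos by (simp add: K_def)
  ultimately show ?thesis
    using that by blast
qed

end

section \<open>Summation over the annuli\<close>

lemma nn_integral_int_geometric_finite:
  fixes \<epsilon> :: real
  assumes "0 < \<epsilon>"
  shows "(\<integral>\<^sup>+ m. ennreal (2 powr (- \<epsilon> * \<bar>real_of_int m\<bar>)) \<partial>count_space UNIV) < \<infinity>"
proof -
  define f where "f m = ennreal (2 powr (- \<epsilon> * \<bar>real_of_int m\<bar>))" for m
  define \<rho> where "\<rho> = 2 powr (- \<epsilon>)"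
  have \<rho>: "0 < \<rho>" "\<rho> < 1"
    using assms powr_less_cancel_iff[of 2 "- \<epsilon>" 0] by (simp_all add: \<rho>_def del: powr_less_cancel_iff)
  have nat: "(\<integral>\<^sup>+ n. ennreal (\<rho> ^ n) \<partial>count_space UNIV) < \<infinity>"
    using \<rho> by (simp add: nn_integral_count_space_nat suminf_ennreal_eq[OF _ geometric_sums])
  have half: "(\<integral>\<^sup>+ m. f m * indicator (range g) m \<partial>count_space UNIV) < \<infinity>"
    if "inj g" "\<And>n. \<bar>g n\<bar> = int n" for g :: "nat \<Rightarrow> int"
  proof -
    have "(\<integral>\<^sup>+ m. f m * indicator (range g) m \<partial>count_space UNIV) = (\<integral>\<^sup>+ m. f m \<partial>count_space (range g))"
      by (subst (2) nn_integral_count_space_indicator) auto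
    also have "\<dots> = (\<integral>\<^sup>+ n. f (g n) \<partial>count_space UNIV)"
      using that(1) by (intro nn_integral_bij_count_space[symmetric] inj_on_imp_bij_betw)
    also have "\<dots> = (\<integral>\<^sup>+ n. ennreal (\<rho> ^ n) \<partial>count_space UNIV)"
    proof (rule nn_integral_cong)
      fix n
      have "\<bar>real_of_int (g n)\<bar> = real n"
        using that(2)[of n] by linarith
      then show "f (g n) = ennreal (\<rho> ^ n)"
        by (simp add: f_def \<rho>_def powr_powr flip: powr_realpow)
    qed
    finally show ?thesis
      using nat by simp
  qed
  have "(\<integral>\<^sup>+ m. f m \<partial>count_space UNIV) \<le>
    (\<integral>\<^sup>+ m. f m * indicator (range int) m + f m * indicator (range (\<lambda>n. - int n)) m \<partial>count_space UNIV)"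
  proof (rule nn_integral_mono)
    fix m :: int
    have "m \<in> range int \<union> range (\<lambda>n. - int n)"
      by (metis UnCI int_cases2 rangeI)
    then show "f m \<le> f m * indicator (range int) m + f m * indicator (range (\<lambda>n. - int n)) m"
      by (auto simp: indicator_def simp del: Un_iff)
  qed
  also have "\<dots> = (\<integral>\<^sup>+ m. f m * indicator (range int) m \<partial>count_space UNIV) +
      (\<integral>\<^sup>+ m. f m * indicator (range (\<lambda>n. - int n)) m \<partial>count_space UNIV)"
    by (rule nn_integral_add) auto
  also have "\<dots> < \<infinity>"
    using half[of int] half[of "\<lambda>n. - int n"] by (simp add: inj_def)
  finally show ?thesis
    unfolding f_def .
qed

text \<open>The shift moves the truncation from \<open>k0\<close> to \<open>k0 + m\<close>; in the
  Morrey norm this costs 2^(m lam), the factor for which the kernel has to make room.\<close>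

lemma nn_integral_count_space_int_shift:
  fixes f :: "int \<Rightarrow> ennreal"
  shows "(\<integral>\<^sup>+ k. f (k + m) \<partial>count_space {..k0}) = (\<integral>\<^sup>+ k. f k \<partial>count_space {..k0 + m})"
proof (rule nn_integral_bij_count_space)
  show "bij_betw (\<lambda>k. k + m) {..k0} {..k0 + m}"
    by (rule bij_betw_byWitness[where f' = "\<lambda>k. k - m"]) auto
qed

text \<open>
  Half of the geometric decay pays for passing from the sum over \<open>m\<close> to the supremum over \<open>m\<close>,
  whose \<open>p\<close>-th power is at most the sum of the \<open>p\<close>-th powers.  In this way all \<open>p > 0\<close> are
  treated alike, without Minkowski's inequality.
\<close>

lemma discrete_convolution_bound:
  fixes \<epsilon> lam p K :: real
  assumes "0 < \<epsilon>" "0 < p" "0 \<le> K"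
  shows "\<exists>K'\<ge>0. \<forall>a t A k0.
    (\<forall>k. t k \<le> ennreal K *
        (\<integral>\<^sup>+ m. ennreal (2 powr (- 2 * \<epsilon> * \<bar>real_of_int m\<bar> - real_of_int m * lam)) * a (k + m) \<partial>count_space UNIV)) \<longrightarrow>
    (\<forall>k0. (\<integral>\<^sup>+ k. ennpow (a k) p \<partial>count_space {..k0}) \<le> ennpow (ennreal (2 powr (real_of_int k0 * lam)) * A) p) \<longrightarrow>
    (\<integral>\<^sup>+ k. ennpow (t k) p \<partial>count_space {..k0}) \<le>
      ennreal K' * ennpow (ennreal (2 powr (real_of_int k0 * lam)) * A) p"
proof -
  define S where "S = (\<integral>\<^sup>+ m. ennreal (2 powr (- \<epsilon> * \<bar>real_of_int m\<bar>)) \<partial>count_space UNIV)"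
  define T where "T = (\<integral>\<^sup>+ m. ennreal (2 powr (- (\<epsilon> * p) * \<bar>real_of_int m\<bar>)) \<partial>count_space UNIV)"
  have fin: "S < \<infinity>" "T < \<infinity>"
    unfolding S_def T_def using assms by (intro nn_integral_int_geometric_finite; simp)+
  define K' where "K' = enn2real (ennpow (ennreal K * S) p * T)"
  have "ennpow (ennreal K * S) p \<noteq> top"
    using fin by (auto simp: ennreal_mult_eq_top_iff)
  then have "ennpow (ennreal K * S) p * T < top"
    using fin unfolding ennreal_mult_less_top less_top by simp
  then have K': "ennreal K' = ennpow (ennreal K * S) p * T"
    by (simp add: K'_def)
  show ?thesis
  proof (intro exI[of _ K'] conjI allI impI)
    show "0 \<le> K'"
      by (simp add: K'_def)
    fix a t :: "int \<Rightarrow> ennreal" and A k0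
    assume t_all: "\<forall>k. t k \<le> ennreal K *
        (\<integral>\<^sup>+ m. ennreal (2 powr (- 2 * \<epsilon> * \<bar>real_of_int m\<bar> - real_of_int m * lam)) * a (k + m) \<partial>count_space UNIV)"
      and a_all: "\<forall>k0. (\<integral>\<^sup>+ k. ennpow (a k) p \<partial>count_space {..k0}) \<le>
        ennpow (ennreal (2 powr (real_of_int k0 * lam)) * A) p"
    note t = t_all[rule_format] and a = a_all[rule_format]
    define c where "c k m = ennreal (2 powr (- \<epsilon> * \<bar>real_of_int m\<bar> - real_of_int m * lam)) * a (k + m)" for k m
    define Z where "Z = ennpow (ennreal (2 powr (real_of_int k0 * lam)) * A) p"
    have t_pow: "ennpow (t k) p \<le> ennpow (ennreal K * S) p * (\<integral>\<^sup>+ m. ennpow (c k m) p \<partial>count_space UNIV)" for k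
    proof -
      define s where "s = ennpow (\<integral>\<^sup>+ m. ennpow (c k m) p \<partial>count_space UNIV) (1 / p)"
      have c_le: "c k m \<le> s" for m
      proof -
        have "c k m = ennpow (ennpow (c k m) p) (1 / p)"
          using \<open>0 < p\<close> by (simp add: ennpow_ennpow)
        also have "\<dots> \<le> s"
          unfolding s_def using \<open>0 < p\<close> by (intro ennpow_mono nn_integral_ge_point) auto
        finally show ?thesis .
      qed
      have "t k \<le> ennreal K * (\<integral>\<^sup>+ m. ennreal (2 powr (- \<epsilon> * \<bar>real_of_int m\<bar>)) * c k m \<partial>count_space UNIV)"
      proof -
        have "ennreal (2 powr (- 2 * \<epsilon> * \<bar>real_of_int m\<bar> - real_of_int m * lam)) =
            ennreal (2 powr (- \<epsilon> * \<bar>real_of_int m\<bar>)) *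
            ennreal (2 powr (- \<epsilon> * \<bar>real_of_int m\<bar> - real_of_int m * lam))" for m
          by (simp add: mult.assoc flip: ennreal_mult powr_add)
        then show ?thesis
          using t[of k] by (simp add: c_def mult.assoc)
      qed
      also have "\<dots> \<le> ennreal K * (\<integral>\<^sup>+ m. ennreal (2 powr (- \<epsilon> * \<bar>real_of_int m\<bar>)) * s \<partial>count_space UNIV)"
        by (intro mult_left_mono nn_integral_mono c_le) auto
      also have "\<dots> = ennreal K * S * s"
        by (simp add: S_def nn_integral_multc mult.assoc)
      finally have "ennpow (t k) p \<le> ennpow (ennreal K * S * s) p"
        using \<open>0 < p\<close> by (intro ennpow_mono) auto
      also have "\<dots> = ennpow (ennreal K * S) p * (\<integral>\<^sup>+ m. ennpow (c k m) p \<partial>count_space UNIV)"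
        using \<open>0 < p\<close> by (simp add: ennpow_mult[of p "ennreal K * S"] s_def ennpow_ennpow)
      finally show ?thesis .
    qed
    have c_sum: "(\<integral>\<^sup>+ k. ennpow (c k m) p \<partial>count_space {..k0}) \<le>
      ennreal (2 powr (- (\<epsilon> * p) * \<bar>real_of_int m\<bar>)) * Z" for m
    proof -
      have "(\<integral>\<^sup>+ k. ennpow (c k m) p \<partial>count_space {..k0}) =
        ennpow (ennreal (2 powr (- \<epsilon> * \<bar>real_of_int m\<bar> - real_of_int m * lam))) p *
        (\<integral>\<^sup>+ k. ennpow (a (k + m)) p \<partial>count_space {..k0})"
        using \<open>0 < p\<close> by (simp add: c_def ennpow_mult nn_integral_cmult)
      also have "\<dots> \<le> ennpow (ennreal (2 powr (- \<epsilon> * \<bar>real_of_int m\<bar> - real_of_int m * lam))) p *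
        ennpow (ennreal (2 powr (real_of_int (k0 + m) * lam)) * A) p"
        unfolding nn_integral_count_space_int_shift[where f = "\<lambda>k. ennpow (a k) p"]
        by (intro mult_left_mono a) auto
      also have "\<dots> = ennpow (ennreal (2 powr (- \<epsilon> * \<bar>real_of_int m\<bar>)) *
        (ennreal (2 powr (real_of_int k0 * lam)) * A)) p"
      proof -
        \<comment> \<open>The factor 2^(-m lam) of the kernel cancels what the shifted truncation
          costs, so pure decay in |m| remains.\<close>
        have "ennreal (2 powr (- \<epsilon> * \<bar>real_of_int m\<bar> - real_of_int m * lam)) *
            ennreal (2 powr (real_of_int (k0 + m) * lam)) =
          ennreal (2 powr (- \<epsilon> * \<bar>real_of_int m\<bar>)) * ennreal (2 powr (real_of_int k0 * lam))"
          by (simp add: algebra_simps flip: ennreal_mult powr_add)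
        then show ?thesis
          using \<open>0 < p\<close> by (simp flip: ennpow_mult mult.assoc)
      qed
      also have "\<dots> = ennreal (2 powr (- (\<epsilon> * p) * \<bar>real_of_int m\<bar>)) * Z"
        unfolding Z_def ennpow_mult[OF \<open>0 < p\<close>, of "ennreal (2 powr (- \<epsilon> * \<bar>real_of_int m\<bar>))"]
        by (simp add: ennpow_ennreal powr_powr mult_ac)
      finally show ?thesis .
    qed
    have "(\<integral>\<^sup>+ k. ennpow (t k) p \<partial>count_space {..k0}) \<le>
      (\<integral>\<^sup>+ k. ennpow (ennreal K * S) p * (\<integral>\<^sup>+ m. ennpow (c k m) p \<partial>count_space UNIV) \<partial>count_space {..k0})"
      by (intro nn_integral_mono t_pow)
    also have "\<dots> = ennpow (ennreal K * S) p *
        (\<integral>\<^sup>+ m. (\<integral>\<^sup>+ k. ennpow (c k m) p \<partial>count_space {..k0}) \<partial>count_space UNIV)"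
      by (subst nn_integral_count_space_nn_integral[symmetric]) (auto simp: nn_integral_cmult)
    also have "\<dots> \<le> ennpow (ennreal K * S) p *
        (\<integral>\<^sup>+ m. ennreal (2 powr (- (\<epsilon> * p) * \<bar>real_of_int m\<bar>)) * Z \<partial>count_space UNIV)"
      by (intro mult_left_mono nn_integral_mono c_sum) auto
    also have "\<dots> = ennreal K' * Z"
      by (simp add: K' T_def nn_integral_multc mult.assoc)
    finally show "(\<integral>\<^sup>+ k. ennpow (t k) p \<partial>count_space {..k0}) \<le>
      ennreal K' * ennpow (ennreal (2 powr (real_of_int k0 * lam)) * A) p"
      unfolding Z_def .
  qed
qed

text \<open>From 1 + x <= exp x at x = \<epsilon> t ln 2; the prefactor restores the coefficient 1
  of t. It absorbs the logarithmic drift of the means of \<open>b\<close> at the price of one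
  \<epsilon>.\<close>

lemma linear_le_exponential:
  fixes \<epsilon> t :: real
  assumes "0 < \<epsilon>" "0 \<le> t"
  shows "1 + t \<le> (1 + 1 / (\<epsilon> * ln 2)) * 2 powr (\<epsilon> * t)"
proof -
  have "1 + \<epsilon> * t * ln 2 \<le> 2 powr (\<epsilon> * t)"
    using exp_ge_add_one_self[of "\<epsilon> * t * ln 2"] by (simp add: powr_def)
  then have "(1 + 1 / (\<epsilon> * ln 2)) * (1 + \<epsilon> * t * ln 2) \<le> (1 + 1 / (\<epsilon> * ln 2)) * 2 powr (\<epsilon> * t)"
    using assms by (intro mult_left_mono) auto
  moreover have "1 + t \<le> (1 + 1 / (\<epsilon> * ln 2)) * (1 + \<epsilon> * t * ln 2)"
    using assms by (simp add: algebra_simps)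
  ultimately show ?thesis
    by linarith
qed

text \<open>For m >= 0 the exponent is -m (\<sigma> + \<alpha>), where the lower condition on
  \<alpha> leaves decay beyond 2^(-m lam); for m < 0 it is -|m| (n - \<sigma> - \<alpha>), where the
  upper condition acts and 2^(-m lam) is at least 1. Of the rate 3 \<epsilon> one part is spent on
  the linear factor, and 2 \<epsilon> remain for \<open>discrete_convolution_bound\<close>.\<close>

lemma (in mixed_exponents) weight_decay:
  fixes \<alpha> lam \<epsilon> :: real
  assumes "0 \<le> lam" "0 < \<epsilon>" "3 * \<epsilon> \<le> \<sigma> + \<alpha> - lam" "3 * \<epsilon> \<le> CARD('n) - \<sigma> - \<alpha>"
  shows "2 powr (real_of_int k * \<alpha>) * (2 powr (real_of_int k * \<sigma>) * weight k (k + m)) \<le>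
    (1 + 1 / (\<epsilon> * ln 2)) * 2 powr (- 2 * \<epsilon> * \<bar>real_of_int m\<bar> - real_of_int m * lam) *
      2 powr (real_of_int (k + m) * \<alpha>)"
proof -
  define u where "u = real_of_int m"
  define v where "v = real_of_int k"
  define e where "e = u * (CARD('n) - \<sigma> - \<alpha>) - max u 0 * CARD('n)"
  have "e \<le> - 3 * \<epsilon> * \<bar>u\<bar> - u * lam"
  proof (cases "0 \<le> u")
    case True
    then have "e = - (u * (\<sigma> + \<alpha> - lam)) - u * lam"
      by (simp add: e_def algebra_simps)
    moreover have "u * (3 * \<epsilon>) \<le> u * (\<sigma> + \<alpha> - lam)"
      using True assms by (intro mult_left_mono) auto
    ultimately show ?thesis
      using True by (simp add: mult_ac)
  next
    case False
    then have "e = - ((CARD('n) - \<sigma> - \<alpha>) * (- u))"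
      by (simp add: e_def)
    moreover have "3 * \<epsilon> * (- u) \<le> (CARD('n) - \<sigma> - \<alpha>) * (- u)"
      using False assms by (intro mult_right_mono) auto
    moreover have "0 \<le> - u * lam"
      using False assms by (intro mult_nonneg_nonneg) auto
    ultimately have "e \<le> - 3 * \<epsilon> * (- u) - u * lam"
      by linarith
    moreover have "\<bar>u\<bar> = - u"
      using False by simp
    ultimately show ?thesis
      by (simp only:)
  qed
  then have e: "2 powr e \<le> 2 powr (- 3 * \<epsilon> * \<bar>u\<bar> - u * lam)"
    by (intro powr_mono) auto
  have max: "real_of_int (max (k + m) k) = v + max u 0"
    by (auto simp: u_def v_def max_def)
  have "2 powr (v * \<alpha>) * (2 powr (v * \<sigma>) * weight k (k + m)) =
    2 powr (v * \<alpha> + v * \<sigma> + ((v + u) * (CARD('n) - \<sigma>) - (v + max u 0) * CARD('n))) * (1 + \<bar>u\<bar>)"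
    unfolding weight_def max by (simp add: u_def v_def powr_add)
  also have "v * \<alpha> + v * \<sigma> + ((v + u) * (CARD('n) - \<sigma>) - (v + max u 0) * CARD('n)) = e + (v + u) * \<alpha>"
    by (simp add: e_def algebra_simps)
  also have "2 powr (e + (v + u) * \<alpha>) * (1 + \<bar>u\<bar>) = (2 powr e * (1 + \<bar>u\<bar>)) * 2 powr ((v + u) * \<alpha>)"
    by (simp add: powr_add)
  also have "\<dots> \<le> (2 powr (- 3 * \<epsilon> * \<bar>u\<bar> - u * lam) * ((1 + 1 / (\<epsilon> * ln 2)) * 2 powr (\<epsilon> * \<bar>u\<bar>))) *
      2 powr ((v + u) * \<alpha>)"
    by (intro mult_right_mono mult_mono e linear_le_exponential assms) auto
  also have "\<dots> = (1 + 1 / (\<epsilon> * ln 2)) * (2 powr (- 3 * \<epsilon> * \<bar>u\<bar> - u * lam) * 2 powr (\<epsilon> * \<bar>u\<bar>)) *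
      2 powr ((v + u) * \<alpha>)"
    by simp
  also have "2 powr (- 3 * \<epsilon> * \<bar>u\<bar> - u * lam) * 2 powr (\<epsilon> * \<bar>u\<bar>) = 2 powr (- 2 * \<epsilon> * \<bar>u\<bar> - u * lam)"
    unfolding powr_add[symmetric] by (rule arg_cong[where f = "\<lambda>s. 2 powr s"]) (simp add: algebra_simps)
  finally show ?thesis
    by (simp add: u_def v_def)
qed

section \<open>Boundedness on the Herz-Morrey space\<close>

lemma e2ennreal_0 [simp]: "e2ennreal 0 = 0"
  by (simp add: zero_ennreal.abs_eq)

lemma e2ennreal_abs_mult_indicator:
  "e2ennreal \<bar>f x * indicator S x\<bar> = e2ennreal \<bar>f x\<bar> * indicator S x"
  by (simp add: indicator_def)

lemma maximal_commutator_eq_enn2ereal: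
  "maximal_commutator b f = (\<lambda>x. enn2ereal (maximal_commutator_enn b (\<lambda>y. e2ennreal \<bar>f y\<bar>) x))"
  by (simp add: fun_eq_iff maximal_commutator_def maximal_commutator_enn_def)

lemma borel_measurable_e2ennreal_abs:
  fixes f :: "'a \<Rightarrow> ereal"
  assumes [measurable]: "f \<in> borel_measurable M"
  shows "(\<lambda>x. e2ennreal \<bar>f x\<bar>) \<in> borel_measurable M"
  by measurable

lemma set_integrable_cball_imp_measurable:
  fixes b :: "real ^ 'n \<Rightarrow> real"
  assumes "\<And>K. compact K \<Longrightarrow> set_integrable lebesgue K b"
  shows "b \<in> borel_measurable lebesgue"
proof (rule borel_measurable_LIMSEQ_real)
  fix n :: nat
  have "set_integrable lebesgue (cball 0 (real n)) b"
    by (rule assms) simp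
  then show "(\<lambda>x. indicator (cball 0 (real n)) x * b x) \<in> borel_measurable lebesgue"
    by (simp add: set_integrable_def integrable_iff_bounded)
next
  fix x :: "real ^ 'n"
  have "eventually (\<lambda>n. norm x \<le> real n) sequentially"
    by real_asymp
  then have "eventually (\<lambda>n. indicator (cball 0 (real n)) x * b x = b x) sequentially"
    by eventually_elim simp
  then show "(\<lambda>n. indicator (cball 0 (real n)) x * b x) \<longlonglongrightarrow> b x"
    by (rule tendsto_eventually)
qed

lemma BMO_mean_oscillation:
  fixes b :: "real ^ 'n \<Rightarrow> real"
  assumes "b \<in> BMO"
  obtains D where "0 < D"
    "\<And>x r. 0 < r \<Longrightarrow> (\<integral>\<^sup>+ y\<in>cball x r. ennreal \<bar>b y - ball_average b x r\<bar> \<partial>lebesgue) \<le>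
      ennreal D * emeasure lebesgue (cball x r)"
proof
  \<comment> \<open>The added 1 keeps the constant positive when the seminorm vanishes.\<close>
  define D where "D = enn2real (BMO_seminorm b) + 1"
  have "BMO_seminorm b < top"
    using assms by (simp add: BMO_def)
  then have D: "BMO_seminorm b \<le> ennreal D"
    by (cases "BMO_seminorm b") (auto simp: D_def intro: ennreal_leI)
  show "0 < D"
    by (simp add: D_def add_nonneg_pos)
  fix x :: "real ^ 'n" and r :: real
  assume r: "0 < r"
  define I where "I = (\<integral>\<^sup>+ y\<in>cball x r. ennreal \<bar>b y - ball_average b x r\<bar> \<partial>lebesgue)"
  define e where "e = emeasure lebesgue (cball x r)"
  define v where "v = unit_ball_vol (CARD('n)) * r ^ CARD('n)"
  have "0 < v"
    using r by (simp add: v_def)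
  moreover have "e = ennreal v"
    unfolding e_def v_def using r by (intro emeasure_lebesgue_cball) auto
  ultimately have e: "e \<noteq> 0" "e \<noteq> top"
    by auto
  have "I / e \<le> BMO_seminorm b"
    unfolding BMO_seminorm_def I_def e_def
    by (rule SUP_upper2[where i = "(x, r)"]) (use r in auto)
  also note D
  finally have "I / e * e \<le> ennreal D * e"
    by (rule mult_right_mono) simp
  also have "I / e * e = I"
    unfolding mult.commute[of _ e] ennreal_times_divide
    unfolding mult.commute[of e] by (rule mult_divide_eq_ennreal[OF e])
  finally show "I \<le> ennreal D * e" .
qed

context bounded_commutator
begin

lemma herz_morrey_norm_eq:
  "herz_morrey_norm \<alpha> lam p q f = (SUP k0::int. ennreal (2 powr (- real_of_int k0 * lam)) *
     ennpow (\<integral>\<^sup>+ k. ennpow (ennreal (2 powr (real_of_int k * \<alpha>)) *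
       N (\<lambda>x. e2ennreal \<bar>f x\<bar> * indicator (dyadic_annulus k) x)) p \<partial>count_space {..k0}) (1 / p))"
  if "0 < p"
  using that
  by (simp add: herz_morrey_norm_def infsum_eq_nn_integral_count_space mixed_norm_eq_N
        e2ennreal_abs_mult_indicator ennpow_mult ennpow_ennreal powr_powr)

text \<open>The maximal commutator ignores the null set \<open>{0}\<close>, which lies in no annulus.\<close>

lemma measurable_M_loc:
  assumes f: "f \<in> mixed_Lebesgue_loc (- {0}) q"
  defines "h \<equiv> \<lambda>y. e2ennreal \<bar>f y\<bar> * indicator (- {0}) y"
  shows "h \<in> borel_measurable lebesgue" "M h \<in> borel_measurable lebesgue"
    "N (\<lambda>y. h y * indicator (dyadic_annulus j) y) < \<infinity>"
proof -
  \<comment> \<open>Compact shells that exhaust the complement of the origin. The truncations have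
    finite norm, so \<open>measurable_M\<close> applies to each, and \<open>M h\<close> is their
    increasing limit.\<close>
  define F where "F i = cball 0 (2 ^ i) - ball (0 :: real ^ 'n::{finite,linorder}) (1 / 2 ^ i)" for i :: nat
  define g where "g i y = h y * indicator (F i) y" for i y
  have loc: "(\<lambda>y. h y * indicator K y) \<in> borel_measurable lebesgue \<and> N (\<lambda>y. h y * indicator K y) < \<infinity>"
    if K: "compact K" "K \<subseteq> - {0}" for K
  proof -
    have 1: "(\<lambda>x. f x * indicator K x) \<in> mixed_Lebesgue q"
      using f K by (auto simp: mixed_Lebesgue_loc_def)
    have 2: "e2ennreal \<bar>f y * indicator K y\<bar> = h y * indicator K y" for y
      using K(2) by (auto simp: h_def indicator_def)
    have "(\<lambda>x. e2ennreal \<bar>f x * indicator K x\<bar>) \<in> borel_measurable lebesgue"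
      using 1 by (intro borel_measurable_e2ennreal_abs) (simp add: mixed_Lebesgue_def)
    then show ?thesis
      using 1 by (simp add: 2 mixed_Lebesgue_def mixed_norm_eq_N)
  qed
  have F: "compact (F i)" "F i \<subseteq> - {0}" for i
    by (auto simp: F_def intro: compact_diff)
  have g: "g i \<in> borel_measurable lebesgue" "N (g i) < \<infinity>" for i
    using loc[OF F, of i] by (simp_all add: g_def[abs_def])
  have "incseq g"
  proof (intro incseq_SucI le_funI)
    fix i y
    have "(2::real) ^ i \<le> 2 ^ Suc i" "1 / 2 ^ Suc i \<le> (1::real) / 2 ^ i"
      by (simp_all add: field_simps)
    then have "F i \<subseteq> F (Suc i)"
      unfolding F_def by (intro Diff_mono subset_cball subset_ball)
    then show "g i y \<le> g (Suc i) y"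
      by (auto simp: g_def indicator_def)
  qed
  have h_SUP: "h y = (SUP i. g i y)" for y
  proof (rule antisym)
    show "(SUP i. g i y) \<le> h y"
      by (rule SUP_least) (auto simp: g_def indicator_def)
    show "h y \<le> (SUP i. g i y)"
    proof (cases "y = 0")
      case False
      obtain i :: nat where "max (norm y) (1 / norm y) < 2 ^ i"
        using real_arch_pow[of 2 "max (norm y) (1 / norm y)"] by auto
      with False have "norm y \<le> 2 ^ i" "1 / 2 ^ i \<le> norm y"
        by (auto simp: field_simps)
      then have "g i y = h y"
        by (simp add: g_def F_def)
      then show ?thesis
        by (metis SUP_upper UNIV_I)
    qed (simp add: h_def)
  qed
  show "h \<in> borel_measurable lebesgue"
    unfolding h_SUP[abs_def] using g by simp
  show "M h \<in> borel_measurable lebesgue"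
  proof -
    have "M h = (\<lambda>x. SUP i. M (g i) x)"
      unfolding h_SUP[abs_def]
      by (intro ext maximal_commutator_enn_SUP measurable_b g \<open>incseq g\<close>)
    then show ?thesis
      using measurable_M[OF g] by simp
  qed
  show "N (\<lambda>y. h y * indicator (dyadic_annulus j) y) < \<infinity>"
  proof -
    define K where "K = cball 0 (2 powr real_of_int j) -
      ball (0 :: real ^ 'n::{finite,linorder}) (2 powr real_of_int (j - 1))"
    have "N (\<lambda>y. h y * indicator (dyadic_annulus j) y) \<le> N (\<lambda>y. h y * indicator K y)"
      by (rule N_mono) (auto simp: indicator_def K_def mem_dyadic_annulus_iff)
    also have "\<dots> < \<infinity>"
    proof -
      have "compact K" "K \<subseteq> - {0}"
        by (auto simp: K_def intro: compact_diff)
      then show ?thesis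
        using loc by blast
    qed
    finally show ?thesis .
  qed
qed

text \<open>A compact set that avoids the origin keeps a positive distance from it and is bounded,
  so finitely many annuli cover it and \<open>N_sum_finite\<close> applies.\<close>

lemma annuli_imp_mixed_Lebesgue_loc:
  assumes g: "g \<in> borel_measurable lebesgue"
    and fin: "\<And>k. N (\<lambda>x. e2ennreal \<bar>g x\<bar> * indicator (dyadic_annulus k) x) < \<infinity>"
  shows "g \<in> mixed_Lebesgue_loc (- {0}) q"
  unfolding mixed_Lebesgue_loc_def mixed_Lebesgue_def
proof (intro CollectI allI impI conjI)
  fix K :: "(real ^ 'n::{finite,linorder}) set"
  assume K: "compact K \<and> K \<subseteq> - {0}"
  then have [measurable]: "K \<in> sets lebesgue"
    by (simp add: compact_imp_closed)
  note [measurable] = g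
  show "(\<lambda>x. g x * indicator K x) \<in> borel_measurable lebesgue"
    by measurable
  have "open (- K)" "0 \<in> - K"
    using K by (auto simp: compact_imp_closed open_Compl)
  then obtain r where r: "0 < r" "ball 0 r \<subseteq> - K"
    using open_contains_ball by blast
  obtain s where s: "0 < s" "\<And>x. x \<in> K \<Longrightarrow> norm x \<le> s"
    using K compact_imp_bounded bounded_pos by metis
  define I where "I = {\<lceil>log 2 r\<rceil>..\<lceil>log 2 s\<rceil>}"
  have cover: "\<exists>k\<in>I. x \<in> dyadic_annulus k" if "x \<in> K" for x
  proof
    show "x \<in> dyadic_annulus \<lceil>log 2 (norm x)\<rceil>"
      using K that by (intro ex_dyadic_annulus) auto
    have "r \<le> norm x" "norm x \<le> s"
      using r that s(2) by (auto simp: subset_iff not_less[symmetric])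
    then show "\<lceil>log 2 (norm x)\<rceil> \<in> I"
      using r(1) by (auto simp: I_def intro!: ceiling_mono log_mono)
  qed
  have "mixed_norm q (\<lambda>x. g x * indicator K x) \<le>
    N (\<lambda>x. \<Sum>k\<in>I. e2ennreal \<bar>g x\<bar> * indicator (dyadic_annulus k) x)"
    unfolding mixed_norm_eq_N e2ennreal_abs_mult_indicator
  proof (rule N_mono)
    fix x
    show "e2ennreal \<bar>g x\<bar> * indicator K x \<le> (\<Sum>k\<in>I. e2ennreal \<bar>g x\<bar> * indicator (dyadic_annulus k) x)"
    proof (cases "x \<in> K")
      case True
      then obtain k where k: "k \<in> I" "x \<in> dyadic_annulus k"
        using cover by blast
      then have "e2ennreal \<bar>g x\<bar> * indicator K x = e2ennreal \<bar>g x\<bar> * indicator (dyadic_annulus k) x"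
        using True by simp
      also have "\<dots> \<le> (\<Sum>k\<in>I. e2ennreal \<bar>g x\<bar> * indicator (dyadic_annulus k) x)"
        by (rule member_le_sum[OF k(1)]) (auto simp: I_def)
      finally show ?thesis .
    qed simp
  qed
  also have "\<dots> < \<infinity>"
    by (rule N_sum_finite[OF _ _ fin]) (auto simp: I_def)
  finally show "mixed_norm q (\<lambda>x. g x * indicator K x) < \<infinity>" .
qed

text \<open>Let \<open>a\<close> and \<open>t\<close> be the weighted norms of the function and of
  its image on the annuli. Then \<open>t\<close> is dominated by a convolution of \<open>a\<close>,
  and the Herz-Morrey norm bounds every truncated sum of \<open>a\<close>: these are the hypotheses
  of \<open>discrete_convolution_bound\<close>.\<close>

lemma bounded_on_herz_morrey:
  assumes "0 \<le> lam" "0 < p" "lam < \<sigma> + \<alpha>" "\<alpha> < CARD('n) - \<sigma>"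
  shows "bounded_operator_on (herz_morrey \<alpha> lam p q) (herz_morrey_norm \<alpha> lam p q)
    (maximal_commutator b)"
proof -
  define \<epsilon> where "\<epsilon> = min (\<sigma> + \<alpha> - lam) (CARD('n) - \<sigma> - \<alpha>) / 3"
  have \<epsilon>: "0 < \<epsilon>" "3 * \<epsilon> \<le> \<sigma> + \<alpha> - lam" "3 * \<epsilon> \<le> CARD('n) - \<sigma> - \<alpha>"
    using assms by (auto simp: \<epsilon>_def)
  obtain K where K: "0 \<le> K"
    "\<And>h k. h \<in> borel_measurable lebesgue \<Longrightarrow>
      (\<And>j. N (\<lambda>y. h y * indicator (dyadic_annulus j) y) < \<infinity>) \<Longrightarrow>
      M h \<in> borel_measurable lebesgue \<Longrightarrow>
      N (\<lambda>x. M h x * indicator (dyadic_annulus k) x) \<le> ennreal K *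
        (\<integral>\<^sup>+ j. ennreal (2 powr (real_of_int k * \<sigma>) * weight k j) *
          N (\<lambda>y. h y * indicator (dyadic_annulus j) y) \<partial>count_space UNIV)"
    using N_M_annulus_le by blast
  define c where "c = 1 + 1 / (\<epsilon> * ln 2)"
  have c: "0 \<le> c"
    using \<epsilon>(1) by (simp add: c_def)
  obtain K' where K': "0 \<le> K'" "\<forall>a t A k0.
    (\<forall>k. t k \<le> ennreal (K * c) *
        (\<integral>\<^sup>+ m. ennreal (2 powr (- 2 * \<epsilon> * \<bar>real_of_int m\<bar> - real_of_int m * lam)) * a (k + m) \<partial>count_space UNIV)) \<longrightarrow>
    (\<forall>k0. (\<integral>\<^sup>+ k. ennpow (a k) p \<partial>count_space {..k0}) \<le> ennpow (ennreal (2 powr (real_of_int k0 * lam)) * A) p) \<longrightarrow>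
    (\<integral>\<^sup>+ k. ennpow (t k) p \<partial>count_space {..k0}) \<le>
      ennreal K' * ennpow (ennreal (2 powr (real_of_int k0 * lam)) * A) p"
    using discrete_convolution_bound[OF \<epsilon>(1) assms(2) mult_nonneg_nonneg[OF K(1) c], of lam] by auto
  show ?thesis
    unfolding bounded_operator_on_def
  proof (intro exI[of _ "K' powr (1 / p)"] ballI)
    fix f assume "f \<in> herz_morrey \<alpha> lam p q"
    then have f: "f \<in> mixed_Lebesgue_loc (- {0}) q" and fin: "herz_morrey_norm \<alpha> lam p q f < \<infinity>"
      by (auto simp: herz_morrey_def)
    define h where "h = (\<lambda>y. e2ennreal \<bar>f y\<bar> * indicator (- {0}) y)"
    have h: "h \<in> borel_measurable lebesgue" "M h \<in> borel_measurable lebesgue"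
      "N (\<lambda>y. h y * indicator (dyadic_annulus j) y) < \<infinity>" for j
      using measurable_M_loc[OF f] by (simp_all add: h_def)
    define A where "A = herz_morrey_norm \<alpha> lam p q f"
    define a where "a k = ennreal (2 powr (real_of_int k * \<alpha>)) * N (\<lambda>y. h y * indicator (dyadic_annulus k) y)" for k
    define t where "t k = ennreal (2 powr (real_of_int k * \<alpha>)) * N (\<lambda>x. M h x * indicator (dyadic_annulus k) x)" for k
    have Mf: "e2ennreal \<bar>maximal_commutator b f x\<bar> = M h x" for x
    proof -
      have "AE y in lebesgue. y \<noteq> (0 :: real ^ 'n::{finite,linorder})"
        by (intro AE_completion AE_lborel_singleton)
      then have "AE y in lebesgue. e2ennreal \<bar>f y\<bar> = h y"
        by eventually_elim (simp add: h_def)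
      then show ?thesis
        unfolding abs_maximal_commutator by (rule maximal_commutator_enn_cong_AE)
    qed
    have Mf': "maximal_commutator b f = (\<lambda>x. enn2ereal (M h x))"
      using Mf[unfolded abs_maximal_commutator]
      by (simp only: maximal_commutator_eq_enn2ereal)
    have hA: "h y * indicator (dyadic_annulus k) y = e2ennreal \<bar>f y\<bar> * indicator (dyadic_annulus k) y" for y k
      by (auto simp: h_def indicator_def mem_dyadic_annulus_iff not_less)
    have norm_f: "A = (SUP k0::int. ennreal (2 powr (- real_of_int k0 * lam)) *
        ennpow (\<integral>\<^sup>+ k. ennpow (a k) p \<partial>count_space {..k0}) (1 / p))"
      by (simp add: A_def herz_morrey_norm_eq[OF assms(2)] a_def hA)
    have norm_Mf: "herz_morrey_norm \<alpha> lam p q (maximal_commutator b f) =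
        (SUP k0::int. ennreal (2 powr (- real_of_int k0 * lam)) *
          ennpow (\<integral>\<^sup>+ k. ennpow (t k) p \<partial>count_space {..k0}) (1 / p))"
      by (simp add: herz_morrey_norm_eq[OF assms(2)] t_def Mf)
    have inv: "ennreal (2 powr (real_of_int k0 * lam)) * ennreal (2 powr (- real_of_int k0 * lam)) = 1" for k0
      by (simp flip: ennreal_mult powr_add)
    have a_le: "(\<integral>\<^sup>+ k. ennpow (a k) p \<partial>count_space {..k0}) \<le> ennpow (ennreal (2 powr (real_of_int k0 * lam)) * A) p" for k0
    proof -
      define X where "X = (\<integral>\<^sup>+ k. ennpow (a k) p \<partial>count_space {..k0})"
      have "ennpow X (1 / p) = ennreal (2 powr (real_of_int k0 * lam)) *
          (ennreal (2 powr (- real_of_int k0 * lam)) * ennpow X (1 / p))"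
        using inv[of k0] by (simp flip: mult.assoc)
      also have "\<dots> \<le> ennreal (2 powr (real_of_int k0 * lam)) * A"
        unfolding norm_f X_def by (intro mult_left_mono SUP_upper) auto
      finally have "ennpow (ennpow X (1 / p)) p \<le> ennpow (ennreal (2 powr (real_of_int k0 * lam)) * A) p"
        using assms(2) by (intro ennpow_mono) auto
      then show ?thesis
        using assms(2) by (simp add: ennpow_ennpow X_def)
    qed
    have t_le: "t k \<le> ennreal (K * c) *
        (\<integral>\<^sup>+ m. ennreal (2 powr (- 2 * \<epsilon> * \<bar>real_of_int m\<bar> - real_of_int m * lam)) * a (k + m) \<partial>count_space UNIV)" for k
    proof -
      define n where "n j = N (\<lambda>y. h y * indicator (dyadic_annulus j) y)" for j
      have "t k \<le> ennreal (2 powr (real_of_int k * \<alpha>)) * (ennreal K *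
          (\<integral>\<^sup>+ j. ennreal (2 powr (real_of_int k * \<sigma>) * weight k j) * n j \<partial>count_space UNIV))"
        unfolding t_def n_def by (intro mult_left_mono K(2) h) auto
      also have "(\<integral>\<^sup>+ j. ennreal (2 powr (real_of_int k * \<sigma>) * weight k j) * n j \<partial>count_space UNIV) =
          (\<integral>\<^sup>+ m. ennreal (2 powr (real_of_int k * \<sigma>) * weight k (k + m)) * n (k + m) \<partial>count_space UNIV)"
        by (rule nn_integral_bij_count_space[symmetric])
           (rule bij_betw_byWitness[where f' = "\<lambda>j. j - k"], auto)
      also have "ennreal (2 powr (real_of_int k * \<alpha>)) * (ennreal K * \<dots>) =
          ennreal K * (\<integral>\<^sup>+ m. ennreal (2 powr (real_of_int k * \<alpha>)) *
            (ennreal (2 powr (real_of_int k * \<sigma>) * weight k (k + m)) * n (k + m)) \<partial>count_space UNIV)"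
        by (subst nn_integral_cmult) (auto simp: mult.left_commute)
      also have "\<dots> \<le> ennreal K * (\<integral>\<^sup>+ m. ennreal c *
          (ennreal (2 powr (- 2 * \<epsilon> * \<bar>real_of_int m\<bar> - real_of_int m * lam)) * a (k + m)) \<partial>count_space UNIV)"
      proof (intro mult_left_mono nn_integral_mono)
        fix m :: int
        have "ennreal (2 powr (real_of_int k * \<alpha>) * (2 powr (real_of_int k * \<sigma>) * weight k (k + m))) * n (k + m) \<le>
          ennreal (c * 2 powr (- 2 * \<epsilon> * \<bar>real_of_int m\<bar> - real_of_int m * lam) * 2 powr (real_of_int (k + m) * \<alpha>)) * n (k + m)"
          unfolding c_def by (intro mult_right_mono ennreal_leI weight_decay assms \<epsilon>) auto
        then show "ennreal (2 powr (real_of_int k * \<alpha>)) *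
            (ennreal (2 powr (real_of_int k * \<sigma>) * weight k (k + m)) * n (k + m)) \<le> ennreal c *
          (ennreal (2 powr (- 2 * \<epsilon> * \<bar>real_of_int m\<bar> - real_of_int m * lam)) * a (k + m))"
          using c weight_pos[of k "k + m"] unfolding a_def n_def
          by (simp only: ennreal_mult powr_ge_zero mult_nonneg_nonneg less_imp_le mult.assoc)
      qed simp
      also have "\<dots> = ennreal (K * c) *
          (\<integral>\<^sup>+ m. ennreal (2 powr (- 2 * \<epsilon> * \<bar>real_of_int m\<bar> - real_of_int m * lam)) * a (k + m) \<partial>count_space UNIV)"
        using K(1) c by (simp add: nn_integral_cmult ennreal_mult mult.assoc)
      finally show ?thesis .
    qed
    have norm_le: "herz_morrey_norm \<alpha> lam p q (maximal_commutator b f) \<le> ennreal (K' powr (1 / p)) * A"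
      unfolding norm_Mf
    proof (rule SUP_least)
      fix k0 :: int
      have "ennpow (\<integral>\<^sup>+ k. ennpow (t k) p \<partial>count_space {..k0}) (1 / p) \<le>
        ennpow (ennreal K' * ennpow (ennreal (2 powr (real_of_int k0 * lam)) * A) p) (1 / p)"
        using assms(2) by (intro ennpow_mono K'(2)[rule_format, OF t_le a_le]) auto
      also have "\<dots> = ennreal (K' powr (1 / p)) * (ennreal (2 powr (real_of_int k0 * lam)) * A)"
        using assms(2) K'(1) by (simp add: ennpow_mult[of "1 / p"] ennpow_ennpow ennpow_ennreal)
      finally have "ennreal (2 powr (- real_of_int k0 * lam)) *
          ennpow (\<integral>\<^sup>+ k. ennpow (t k) p \<partial>count_space {..k0}) (1 / p) \<le>
        ennreal (2 powr (- real_of_int k0 * lam)) *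
          (ennreal (K' powr (1 / p)) * (ennreal (2 powr (real_of_int k0 * lam)) * A))"
        by (rule mult_left_mono) simp
      also have "\<dots> = (ennreal (2 powr (real_of_int k0 * lam)) * ennreal (2 powr (- real_of_int k0 * lam))) *
          (ennreal (K' powr (1 / p)) * A)"
        by (simp only: mult_ac)
      finally show "ennreal (2 powr (- real_of_int k0 * lam)) *
          ennpow (\<integral>\<^sup>+ k. ennpow (t k) p \<partial>count_space {..k0}) (1 / p) \<le> ennreal (K' powr (1 / p)) * A"
        unfolding inv by simp
    qed
    have Mf_fin: "herz_morrey_norm \<alpha> lam p q (maximal_commutator b f) < \<infinity>"
      using fin by (intro le_less_trans[OF norm_le]) (simp add: A_def ennreal_mult_less_top)
    \<comment> \<open>Membership of the image in the local space rests on finiteness on each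
      annulus; \<open>t k\<close> is a term of the sum truncated at k.\<close>
    have t_fin: "t k < \<infinity>" for k
    proof -
      have "ennpow (t k) p \<le> (\<integral>\<^sup>+ k. ennpow (t k) p \<partial>count_space {..k})"
        by (rule nn_integral_ge_point) simp
      also have "\<dots> \<le> ennreal K' * ennpow (ennreal (2 powr (real_of_int k * lam)) * A) p"
        by (rule K'(2)[rule_format, OF t_le a_le])
      also have "\<dots> < \<infinity>"
        using fin by (simp add: A_def ennreal_mult_less_top ennpow_mult[OF assms(2)] ennpow_ennreal less_top[symmetric]
            ennreal_mult_eq_top_iff)
      finally show ?thesis
        by (simp add: less_top[symmetric])
    qed
    have "maximal_commutator b f \<in> mixed_Lebesgue_loc (- {0}) q"
    proof (rule annuli_imp_mixed_Lebesgue_loc)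
      show "maximal_commutator b f \<in> borel_measurable lebesgue"
        unfolding Mf' using h(2) by simp
      show "N (\<lambda>x. e2ennreal \<bar>maximal_commutator b f x\<bar> * indicator (dyadic_annulus k) x) < \<infinity>" for k
        unfolding Mf using t_fin[of k] by (auto simp: t_def ennreal_mult_less_top)
    qed
    with Mf_fin norm_le show "maximal_commutator b f \<in> herz_morrey \<alpha> lam p q \<and>
        herz_morrey_norm \<alpha> lam p q (maximal_commutator b f) \<le>
          ennreal (K' powr (1 / p)) * herz_morrey_norm \<alpha> lam p q f"
      by (simp add: herz_morrey_def A_def)
  qed
qed

end

theorem theorem4p1:
  fixes q :: "real ^ 'n::{finite,linorder}"
    and \<alpha> lam p :: real
    and b :: "real ^ 'n::{finite,linorder} \<Rightarrow> real"
  assumes "0 \<le> lam"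
    and "0 < p"
    and "\<And>i. 1 < q $ i"
    and "- (\<Sum>i\<in>UNIV. 1 / q $ i) + lam < \<alpha>"
    and "\<alpha> < real CARD('n) * (1 - 1 / real CARD('n) * (\<Sum>i\<in>UNIV. 1 / q $ i))"
    and "b \<in> BMO"
    and "bounded_operator_on (mixed_Lebesgue q) (mixed_norm q) (maximal_commutator b)"
  shows "bounded_operator_on (herz_morrey \<alpha> lam p q) (herz_morrey_norm \<alpha> lam p q)
           (maximal_commutator b)"
proof -
  interpret mixed_exponents q
    by standard (rule assms(3))
  obtain D where D: "0 < D"
    "\<And>x r. 0 < r \<Longrightarrow> (\<integral>\<^sup>+ y\<in>cball x r. ennreal \<bar>b y - ball_average b x r\<bar> \<partial>lebesgue) \<le>
      ennreal D * emeasure lebesgue (cball x r)"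
    using BMO_mean_oscillation[OF assms(6)] by blast
  obtain C where C: "\<And>f. f \<in> mixed_Lebesgue q \<Longrightarrow> maximal_commutator b f \<in> mixed_Lebesgue q"
    "\<And>f. f \<in> mixed_Lebesgue q \<Longrightarrow> mixed_norm q (maximal_commutator b f) \<le> ennreal C * mixed_norm q f"
    using assms(7) unfolding bounded_operator_on_def by blast
  \<comment> \<open>The constant in \<open>bounded_operator_on\<close> may be any real, even
    negative; the maximum makes it positive.\<close>
  interpret bounded_commutator q b "max C 1" "\<lambda>k. ball_average b 0 (2 powr real_of_int k)" D
  proof
    show "b \<in> borel_measurable lebesgue"
      using assms(6) by (intro set_integrable_cball_imp_measurable) (simp add: BMO_def)
    show "0 < D" "0 < max C 1"
      using D(1) by auto
    show "(\<integral>\<^sup>+ y\<in>cball 0 (2 powr real_of_int k).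
        ennreal \<bar>b y - ball_average b 0 (2 powr real_of_int k)\<bar> \<partial>lebesgue) \<le>
      ennreal D * emeasure lebesgue (cball (0 :: real ^ 'n::{finite,linorder}) (2 powr real_of_int k))" for k
      by (rule D(2)) simp
    fix h :: "real ^ 'n::{finite,linorder} \<Rightarrow> ennreal"
    assume [measurable]: "h \<in> borel_measurable lebesgue" and fin: "N h < \<infinity>"
    have h: "(\<lambda>x. enn2ereal (h x)) \<in> mixed_Lebesgue q"
      using fin by (simp add: mixed_Lebesgue_def mixed_norm_eq_N)
    have Mh: "maximal_commutator_enn b h = (\<lambda>x. e2ennreal \<bar>maximal_commutator b (\<lambda>x. enn2ereal (h x)) x\<bar>)"
      by (simp add: abs_maximal_commutator)
    \<comment> \<open>Measurability is read off from the image lying in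
      \<open>mixed_Lebesgue q\<close>, which \<open>bounded_operator_on\<close> includes.\<close>
    show "maximal_commutator_enn b h \<in> borel_measurable lebesgue"
      unfolding Mh using C(1)[OF h] by (intro borel_measurable_e2ennreal_abs) (simp add: mixed_Lebesgue_def)
    have "N (maximal_commutator_enn b h) = mixed_norm q (maximal_commutator b (\<lambda>x. enn2ereal (h x)))"
      unfolding Mh mixed_norm_eq_N ..
    also have "\<dots> \<le> ennreal C * N h"
      using C(2)[OF h] by (simp add: mixed_norm_eq_N)
    also have "\<dots> \<le> ennreal (max C 1) * N h"
      by (intro mult_right_mono ennreal_leI) auto
    finally show "N (maximal_commutator_enn b h) \<le> ennreal (max C 1) * N h" .
  qed
  show ?thesis
  proof (rule bounded_on_herz_morrey[OF assms(1,2)])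
    show "lam < \<sigma> + \<alpha>"
      using assms(4) by (simp add: \<sigma>_def)
    show "\<alpha> < CARD('n) - \<sigma>"
      using assms(5) by (simp add: \<sigma>_def right_diff_distrib)
  qed
qed

end
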